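(* Consider a sequence of hub models with a null component with $n_L\to\infty$, $n\to\infty$, $T\to\infty$, satisfying the standing assumption on $\rho$ in the context. Let $d,v\in(0,1]$ (possibly depending on the index of the sequence) be such that: (i) for each $i=1,\dots,n_L$ there exists a set $V_i\subset\{1,\dots,n\}$ with $|V_i|\ge vn/n_L$ and $A_{ij}-A_{i'j}\ge d$ for all $j\in V_i$ and all $i'\in\{0,1,\dots,n_L\}$, $i'\ne i$; (ii) $A_{ii'}\le c_0/n_L$ for all $i\in\{0,\dots,n_L\}$, $i'\in\{1,\dots,n_L\}$, $i\ne i'$, where $c_0$ is a positive constant. If $(n_L^2\log n_L)/T=o(1)$, $(n_L^5\log T)/(d^2vT)=o(1)$, $(n_L^8\log n_L)/(d^4v^2n)=o(1)$ and $(n_L\log n)/T=o(1)$, then $$\max_{i\in\{0,\dots,n_L\},\,j\in\{1,\dots,n\}}\left|\hat A^{\hat z}_{ij}-A_{ij}\right|=o_p(1).$$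
   Context: Hub model with a null component: nodes $1,\dots,n$; leaders (possible hubs) $1,\dots,n_L$ with $n_L\le n$; label $0$ denotes a hubless group. Parameters: $\rho=(\rho_0,\dots,\rho_{n_L})$ with $\rho_i\ge0$, $\sum_{i=0}^{n_L}\rho_i=1$, and $A=(A_{ij})_{0\le i\le n_L,1\le j\le n}$ with entries in $[0,1]$ and $A_{ii}=1$ for $1\le i\le n_L$ (row $0$ is also denoted $\pi_j=A_{0j}$). Independently for $t=1,\dots,T$, a latent label $z_*^{(t)}\in\{0,\dots,n_L\}$ is drawn with $\mathbb P(z_*^{(t)}=i)=\rho_i$, and given $z_*^{(t)}=i$ the variables $G_j^{(t)}\in\{0,1\}$, $j=1,\dots,n$, are independent with $\mathbb P(G_j^{(t)}=1\mid z_*^{(t)}=i)=A_{ij}$. Only $G$ is observed. Profile likelihood estimator: for an assignment $z=(z^{(1)},\dots,z^{(T)})\in\{0,\dots,n_L\}^T$ let $t_i=\sum_t1(z^{(t)}=i)$, $\hat A^z_{ij}=\frac1{t_i}\sum_tG_j^{(t)}1(z^{(t)}=i)$ (set to $0$, say, if $t_i=0$), and $$L_G(z)=\sum_{t=1}^T\sum_{j=1}^n G_j^{(t)}\log\hat A^z_{z^{(t)},j}+(1-G_j^{(t)})\log(1-\hat A^z_{z^{(t)},j}),\qquad 0\log0=0.$$ An assignment is feasible if, for every $t$, either $z^{(t)}=0$ or $G^{(t)}_{z^{(t)}}=1$. $\hat z$ is a maximizer of $L_G(z)$ over feasible assignments, and $\hat A^{\hat z}$ is $\hat A^z$ at $z=\hat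 z$. Asymptotics: $n_L,n,T,\rho,A,d,v$ all vary along a sequence; $o(1)$ and $o_p(1)$ are along this sequence, and "constant" means independent of the sequence index. Standing assumption: $\min_{0\le i\le n_L}\rho_i=c_{\min*}/n_L$ and $\max_{0\le i\le n_L}\rho_i=c_{\max*}/n_L$ with positive constants $c_{\min*},c_{\max*}$. *)

theory Defs
  imports "HOL-Probability.Probability"
begin

text \<open>
  The hub model with a null component. Labels are \<open>0, ..., nL\<close> (label \<open>0\<close> is the hubless group),
  nodes are \<open>1, ..., n\<close> and observations are \<open>1, ..., T\<close>. Binary variables are encoded as
  \<open>bool\<close>. Values of functions outside these index ranges are irrelevant.

  The vector of observation \<open>t\<close> is restricted to the nodes \<open>1, ..., n\<close>, so it has finitely many
  possible values of \<open>G\<close> and the discrete \<open>\<sigma>\<close>-algebra is the appropriate one. Conditioning is only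
  specified on labels of positive probability.
\<close>

locale hub_model = prob_space M
  for M :: "'a measure" +
  fixes nL n T :: nat
    and \<rho> :: "nat \<Rightarrow> real"
    and A :: "nat \<Rightarrow> nat \<Rightarrow> real"
    and Z :: "nat \<Rightarrow> 'a \<Rightarrow> nat"
    and G :: "nat \<Rightarrow> nat \<Rightarrow> 'a \<Rightarrow> bool"
  assumes nL_le_n: "nL \<le> n"
    and rho_nonneg: "\<And>i. i \<in> {0..nL} \<Longrightarrow> 0 \<le> \<rho> i"
    and rho_sum: "(\<Sum>i = 0..nL. \<rho> i) = 1"
    and A_range: "\<And>i j. i \<in> {0..nL} \<Longrightarrow> j \<in> {1..n} \<Longrightarrow> A i j \<in> {0..1}"
    and A_diag: "\<And>i. i \<in> {1..nL} \<Longrightarrow> A i i = 1"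
    and indep_observations:
      "indep_vars (\<lambda>_. count_space UNIV) (\<lambda>t \<omega>. (Z t \<omega>, \<lambda>j\<in>{1..n}. G t j \<omega>)) {1..T}"
    and label_prob:
      "\<And>t i. t \<in> {1..T} \<Longrightarrow> i \<in> {0..nL} \<Longrightarrow> prob {\<omega> \<in> space M. Z t \<omega> = i} = \<rho> i"
    and cond_marginal:
      "\<And>t i j. t \<in> {1..T} \<Longrightarrow> i \<in> {0..nL} \<Longrightarrow> 0 < \<rho> i \<Longrightarrow> j \<in> {1..n} \<Longrightarrow>
         cond_prob M (\<lambda>\<omega>. G t j \<omega>) (\<lambda>\<omega>. Z t \<omega> = i) = A i j"
    and cond_indep:
      "\<And>t i g. t \<in> {1..T} \<Longrightarrow> i \<in> {0..nL} \<Longrightarrow> 0 < \<rho> i \<Longrightarrow>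
         cond_prob M (\<lambda>\<omega>. \<forall>j\<in>{1..n}. G t j \<omega> = g j) (\<lambda>\<omega>. Z t \<omega> = i) =
         (\<Prod>j = 1..n. cond_prob M (\<lambda>\<omega>. G t j \<omega> = g j) (\<lambda>\<omega>. Z t \<omega> = i))"

definition group_size :: "nat \<Rightarrow> (nat \<Rightarrow> nat) \<Rightarrow> nat \<Rightarrow> nat" where
  "group_size T z i = card {t \<in> {1..T}. z t = i}"

text \<open>For an empty group the estimate is \<open>0\<close>, since \<open>x / 0 = 0\<close>.\<close>

definition A_hat :: "nat \<Rightarrow> (nat \<Rightarrow> nat \<Rightarrow> bool) \<Rightarrow> (nat \<Rightarrow> nat) \<Rightarrow> nat \<Rightarrow> nat \<Rightarrow> real" where
  "A_hat T g z i j =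
     (\<Sum>t = 1..T. of_bool (g t j) * of_bool (z t = i)) / real (group_size T z i)"

text \<open>
  The convention \<open>0 log 0 = 0\<close> is automatic. The junk value \<open>ln 0 = 0\<close> never stands for
  \<open>- \<infinity>\<close> here: if \<open>g t j\<close> holds then \<open>A_hat T g z (z t) j > 0\<close>, and otherwise it is \<open>< 1\<close>,
  because observation \<open>t\<close> itself belongs to group \<open>z t\<close>.
\<close>

definition profile_loglik ::
  "nat \<Rightarrow> nat \<Rightarrow> (nat \<Rightarrow> nat \<Rightarrow> bool) \<Rightarrow> (nat \<Rightarrow> nat) \<Rightarrow> real" where
  "profile_loglik n T g z =
     (\<Sum>t = 1..T. \<Sum>j = 1..n.
        of_bool (g t j) * ln (A_hat T g z (z t) j)
        + (1 - of_bool (g t j)) * ln (1 - A_hat T g z (z t) j))"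

definition feasible :: "nat \<Rightarrow> nat \<Rightarrow> (nat \<Rightarrow> nat \<Rightarrow> bool) \<Rightarrow> (nat \<Rightarrow> nat) \<Rightarrow> bool" where
  "feasible nL T g z \<longleftrightarrow> (\<forall>t\<in>{1..T}. z t \<in> {0..nL} \<and> (z t = 0 \<or> g t (z t)))"

definition profile_mle ::
  "nat \<Rightarrow> nat \<Rightarrow> nat \<Rightarrow> (nat \<Rightarrow> nat \<Rightarrow> bool) \<Rightarrow> (nat \<Rightarrow> nat) \<Rightarrow> bool" where
  "profile_mle nL n T g z \<longleftrightarrow> is_arg_max (profile_loglik n T g) (feasible nL T g) z"

text \<open>\<open>X k = o_p(1)\<close>, where each \<open>X k\<close> lives on its own probability space \<open>M k\<close>.\<close>

definition small_o_p_1 :: "(nat \<Rightarrow> 'a measure) \<Rightarrow> (nat \<Rightarrow> 'a \<Rightarrow> real) \<Rightarrow> bool" where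
  "small_o_p_1 M X \<longleftrightarrow>
     (\<forall>\<epsilon>>0. (\<lambda>k. measure (M k) {\<omega> \<in> space (M k). \<bar>X k \<omega>\<bar> > \<epsilon>}) \<longlonglongrightarrow> 0)"

end

theory Submission
  imports Defs
begin

text \<open>
  The true labels with the true matrix \<open>A\<close> are compared with a competing labelling \<open>z\<close> and matrix \<open>B\<close>
  through the square root of their likelihood ratio. Its conditional mean is a product of Hellinger
  affinities, at most the exponential of minus a quarter of the squared distance between the two
  \<open>T \<times> n\<close> arrays of edge probabilities. For a given \<open>z\<close> the matrix of group frequencies takes at most
  \<open>(T + 1)\<^bsup>(nL + 1) n\<^esup>\<close> values, so a union bound over all \<open>z\<close> and all these matrices bounds the
  squared error of the maximiser by a multiple of \<open>T ln (nL + 1) + (nL + 1) n ln (T + 1)\<close>.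
  By separation, two classes that both have many members in the same estimated group would cost more
  than that. Hence the estimated groups are the true classes up to a permutation and \<open>o(T / nL)\<close>
  errors per group. Feasibility and the sparsity of the leader columns force the permutation to be
  the identity, and Bernstein's inequality within the true classes gives the claim.
\<close>

section \<open>Concentration of centred sums\<close>

text \<open>For negative \<open>x = - y\<close> the claim reads
  \<open>1 \<le> exp y * (1 - y + y^2)\<close>. Replacing \<open>exp y\<close> by its quadratic
  Taylor polynomial turns the product into \<open>1\<close> plus nonnegative powers of
  \<open>y\<close>.\<close>

lemma exp_le_quadratic:
  fixes x :: real
  assumes "\<bar>x\<bar> \<le> 1"
  shows "exp x \<le> 1 + x + x\<^sup>2"
proof (cases "0 \<le> x")
  case True
  then show ?thesis using assms by (intro exp_bound) auto
next
  case False
  define y where "y = - x"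
  have y: "0 \<le> y" using False by (simp add: y_def)
  have "1 \<le> 1 + y\<^sup>2 / 2 + y ^ 3 / 2 + y ^ 4 / 2"
    using y by (simp add: add_nonneg_nonneg)
  also have "\<dots> = (1 + y + y\<^sup>2 / 2) * (1 - y + y\<^sup>2)"
    by (simp add: field_simps power2_eq_square power3_eq_cube power4_eq_xxxx)
  also have "\<dots> \<le> exp y * (1 - y + y\<^sup>2)"
  proof (intro mult_right_mono exp_lower_Taylor_quadratic y)
    have "1 - y + y\<^sup>2 = (y - 1/2)\<^sup>2 + 3/4"
      by (simp add: power2_eq_square algebra_simps)
    then show "0 \<le> 1 - y + y\<^sup>2" by simp
  qed
  finally have "exp x * 1 \<le> exp x * (exp y * (1 - y + y\<^sup>2))"
    by (intro mult_left_mono) auto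
  also have "\<dots> = 1 - y + y\<^sup>2"
    by (simp add: y_def exp_minus field_simps)
  finally show ?thesis by (simp add: y_def)
qed

text \<open>Markov's inequality for a product whose mean factorises by independence. It serves both
  the exponential moments below and the tilted likelihood ratios.\<close>

lemma (in prob_space) prob_prod_ge:
  fixes Y :: "'b \<Rightarrow> 'a \<Rightarrow> real"
  assumes I: "finite I"
    and indep: "indep_vars (\<lambda>_. borel) Y I"
    and int: "\<And>t. t \<in> I \<Longrightarrow> integrable M (Y t)"
    and nonneg: "\<And>t \<omega>. t \<in> I \<Longrightarrow> \<omega> \<in> space M \<Longrightarrow> 0 \<le> Y t \<omega>"
    and le: "\<And>t. t \<in> I \<Longrightarrow> expectation (Y t) \<le> c t"
    and a: "0 < a"
  shows "prob {\<omega>\<in>space M. a \<le> (\<Prod>t\<in>I. Y t \<omega>)} \<le> (\<Prod>t\<in>I. c t) / a"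
proof -
  have "prob {\<omega>\<in>space M. a \<le> (\<Prod>t\<in>I. Y t \<omega>)} \<le> expectation (\<lambda>\<omega>. \<Prod>t\<in>I. Y t \<omega>) / a"
    using a by (intro integral_Markov_inequality_measure[where A = "{}"] indep_vars_integrable I indep int)
      (auto intro!: AE_I2 prod_nonneg nonneg)
  also have "expectation (\<lambda>\<omega>. \<Prod>t\<in>I. Y t \<omega>) = (\<Prod>t\<in>I. expectation (Y t))"
    by (intro indep_vars_lebesgue_integral I indep int)
  also have "\<dots> \<le> (\<Prod>t\<in>I. c t)"
    by (intro prod_mono conjI Bochner_Integration.integral_nonneg le nonneg)
  finally show ?thesis using a by (simp add: divide_right_mono)
qed

text \<open>A Chernoff bound with its parameter \<open>l\<close> left free. By
  \<open>exp x \<le> 1 + x + x^2\<close> each factor has mean at most \<open>exp (l^2 * r)\<close>.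
  Working with the second moment rather than the range matters because the class indicators have
  variance of order \<open>1 / nL\<close>.\<close>

lemma (in prob_space) prob_sum_ge:
  fixes X :: "'b \<Rightarrow> 'a \<Rightarrow> real" and l r s :: real
  assumes I: "finite I"
    and indep: "indep_vars (\<lambda>_. borel) X I"
    and bounded: "\<And>t \<omega>. t \<in> I \<Longrightarrow> \<omega> \<in> space M \<Longrightarrow> \<bar>X t \<omega>\<bar> \<le> 1"
    and centred: "\<And>t. t \<in> I \<Longrightarrow> expectation (X t) = 0"
    and second_moment: "\<And>t. t \<in> I \<Longrightarrow> expectation (\<lambda>\<omega>. (X t \<omega>)\<^sup>2) \<le> r"
    and l: "\<bar>l\<bar> \<le> 1"
  shows "prob {\<omega>\<in>space M. s \<le> l * (\<Sum>t\<in>I. X t \<omega>)} \<le> exp (l\<^sup>2 * card I * r - s)"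
proof -
  have rv [measurable]: "random_variable borel (X t)" if "t \<in> I" for t
    using indep that by (auto simp: indep_vars_def)
  have int: "integrable M (X t)" "integrable M (\<lambda>\<omega>. (X t \<omega>)\<^sup>2)"
    "integrable M (\<lambda>\<omega>. exp (l * X t \<omega>))" if t: "t \<in> I" for t
  proof -
    have [measurable]: "random_variable borel (X t)" by (rule rv[OF t])
    have lX: "\<bar>l * X t \<omega>\<bar> \<le> 1" if "\<omega> \<in> space M" for \<omega>
      using mult_mono[OF l bounded[OF t that]] by (simp add: abs_mult)
    show "integrable M (X t)"
      using bounded[OF t] by (intro integrable_const_bound[where B = 1]) auto
    show "integrable M (\<lambda>\<omega>. (X t \<omega>)\<^sup>2)"
      using bounded[OF t] by (intro integrable_const_bound[where B = 1]) (auto simp: abs_square_le_1)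
    show "integrable M (\<lambda>\<omega>. exp (l * X t \<omega>))"
      using lX by (intro integrable_const_bound[where B = "exp 1"]) (auto simp: abs_le_iff)
  qed
  have mgf: "expectation (\<lambda>\<omega>. exp (l * X t \<omega>)) \<le> exp (l\<^sup>2 * r)" if t: "t \<in> I" for t
  proof -
    have "expectation (\<lambda>\<omega>. exp (l * X t \<omega>)) \<le> expectation (\<lambda>\<omega>. 1 + l * X t \<omega> + l\<^sup>2 * (X t \<omega>)\<^sup>2)"
    proof (intro integral_mono)
      show "exp (l * X t \<omega>) \<le> 1 + l * X t \<omega> + l\<^sup>2 * (X t \<omega>)\<^sup>2" if "\<omega> \<in> space M" for \<omega>
      proof -
        have "\<bar>l * X t \<omega>\<bar> \<le> 1"
          using mult_mono[OF l bounded[OF t that]] by (simp add: abs_mult)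
        from exp_le_quadratic[OF this] show ?thesis by (simp add: power_mult_distrib)
      qed
    qed (use int[OF t] in auto)
    also have "\<dots> = 1 + l\<^sup>2 * expectation (\<lambda>\<omega>. (X t \<omega>)\<^sup>2)"
      using int[OF t] centred[OF t] by (simp add: prob_space)
    also have "\<dots> \<le> 1 + l\<^sup>2 * r"
      using second_moment[OF t] by (simp add: mult_left_mono)
    also have "\<dots> \<le> exp (l\<^sup>2 * r)"
      by (rule exp_ge_add_one_self)
    finally show ?thesis .
  qed
  have "{\<omega>\<in>space M. s \<le> l * (\<Sum>t\<in>I. X t \<omega>)} = {\<omega>\<in>space M. exp s \<le> (\<Prod>t\<in>I. exp (l * X t \<omega>))}"
    by (simp add: I exp_sum[symmetric] sum_distrib_left)
  also have "prob \<dots> \<le> (\<Prod>t\<in>I. exp (l\<^sup>2 * r)) / exp s"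
    by (intro prob_prod_ge I int mgf indep_vars_compose2[OF indep]) auto
  also have "\<dots> = exp (l\<^sup>2 * card I * r - s)"
    by (simp add: exp_diff exp_of_nat_mult[symmetric] mult_ac)
  finally show ?thesis .
qed

lemma (in prob_space) prob_abs_sum_ge:
  fixes X :: "'b \<Rightarrow> 'a \<Rightarrow> real" and l r s :: real
  assumes I: "finite I"
    and indep: "indep_vars (\<lambda>_. borel) X I"
    and bounded: "\<And>t \<omega>. t \<in> I \<Longrightarrow> \<omega> \<in> space M \<Longrightarrow> \<bar>X t \<omega>\<bar> \<le> 1"
    and centred: "\<And>t. t \<in> I \<Longrightarrow> expectation (X t) = 0"
    and second_moment: "\<And>t. t \<in> I \<Longrightarrow> expectation (\<lambda>\<omega>. (X t \<omega>)\<^sup>2) \<le> r"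
    and l: "0 < l" "l \<le> 1"
  shows "prob {\<omega>\<in>space M. s \<le> \<bar>\<Sum>t\<in>I. X t \<omega>\<bar>} \<le> 2 * exp (l\<^sup>2 * card I * r - l * s)"
proof -
  have rv [measurable]: "random_variable borel (X t)" if "t \<in> I" for t
    using indep that by (auto simp: indep_vars_def)
  let ?S = "\<lambda>\<sigma>. {\<omega>\<in>space M. l * s \<le> \<sigma> * (\<Sum>t\<in>I. X t \<omega>)}"
  \<comment> \<open>The sign of the parameter selects the tail. Only its square enters the bound, so
    both tails have the same one.\<close>
  have tail: "prob (?S \<sigma>) \<le> exp (l\<^sup>2 * card I * r - l * s)" if "\<bar>\<sigma>\<bar> = \<bar>l\<bar>" for \<sigma>
  proof -
    have "\<bar>\<sigma>\<bar> \<le> 1" using that l by simp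
    then have "prob (?S \<sigma>) \<le> exp (\<sigma>\<^sup>2 * card I * r - l * s)"
      by (intro prob_sum_ge I indep bounded centred second_moment)
    moreover have "\<sigma>\<^sup>2 = l\<^sup>2" using that by (simp add: power2_eq_iff abs_eq_iff)
    ultimately show ?thesis by simp
  qed
  have scale: "s \<le> \<bar>y\<bar> \<longleftrightarrow> l * s \<le> l * y \<or> l * s \<le> - l * y" for y
    using mult_le_cancel_left_pos[OF l(1), of s y] mult_le_cancel_left_pos[OF l(1), of s "- y"]
    unfolding mult_minus_right mult_minus_left by linarith
  have "{\<omega>\<in>space M. s \<le> \<bar>\<Sum>t\<in>I. X t \<omega>\<bar>} = ?S l \<union> ?S (- l)"
    unfolding scale by blast
  then have "prob {\<omega>\<in>space M. s \<le> \<bar>\<Sum>t\<in>I. X t \<omega>\<bar>} = prob (?S l \<union> ?S (- l))"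
    by (rule arg_cong)
  also have "\<dots> \<le> prob (?S l) + prob (?S (- l))"
    by (intro measure_Un_le) measurable
  also have "\<dots> \<le> exp (l\<^sup>2 * card I * r - l * s) + exp (l\<^sup>2 * card I * r - l * s)"
    using tail[of l] tail[of "- l"] by linarith
  finally show ?thesis by simp
qed

section \<open>Bernoulli likelihoods\<close>

definition bern :: "real \<Rightarrow> bool \<Rightarrow> real" where
  "bern p b = (if b then p else 1 - p)"

lemma bern_nonneg: "p \<in> {0..1} \<Longrightarrow> 0 \<le> bern p b"
  by (auto simp: bern_def)

text \<open>The affinity is one minus half the sum of the squared root differences of the two
  outcome probabilities. Since \<open>sqrt x + sqrt y \<le> 2\<close> on the unit interval, each of
  these squares is at least \<open>(p - q)^2 / 4\<close>.\<close>

lemma hellinger_affinity_le: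
  fixes p q :: real
  assumes "p \<in> {0..1}" "q \<in> {0..1}"
  shows "sqrt (p * q) + sqrt ((1 - p) * (1 - q)) \<le> exp (- (p - q)\<^sup>2 / 4)"
proof -
  have diff: "(x - y)\<^sup>2 \<le> 4 * (sqrt x - sqrt y)\<^sup>2" if "x \<in> {0..1}" "y \<in> {0..1}" for x y :: real
  proof -
    have "x - y = (sqrt x + sqrt y) * (sqrt x - sqrt y)"
      using that by (simp add: algebra_simps)
    then have "(x - y)\<^sup>2 = (sqrt x + sqrt y)\<^sup>2 * (sqrt x - sqrt y)\<^sup>2"
      by (simp add: power_mult_distrib)
    also have "\<dots> \<le> 2\<^sup>2 * (sqrt x - sqrt y)\<^sup>2"
    proof (intro mult_right_mono power_mono)
      have "sqrt x \<le> 1" "sqrt y \<le> 1" using that by auto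
      then show "sqrt x + sqrt y \<le> 2" by linarith
    qed (use that in auto)
    finally show ?thesis by simp
  qed
  have sq: "(sqrt x - sqrt y)\<^sup>2 = x + y - 2 * sqrt (x * y)" if "x \<in> {0..1}" "y \<in> {0..1}" for x y :: real
    using that by (simp add: power2_diff real_sqrt_mult)
  have "(p - q)\<^sup>2 \<le> 4 * (p + q - 2 * sqrt (p * q))"
    using diff[OF assms] sq[OF assms] by simp
  moreover have "(p - q)\<^sup>2 \<le> 4 * ((1 - p) + (1 - q) - 2 * sqrt ((1 - p) * (1 - q)))"
    using diff[of "1 - p" "1 - q"] sq[of "1 - p" "1 - q"] assms by (simp add: power2_commute)
  ultimately have "sqrt (p * q) + sqrt ((1 - p) * (1 - q)) \<le> 1 + - (p - q)\<^sup>2 / 4"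
    by simp
  also have "\<dots> \<le> exp (- (p - q)\<^sup>2 / 4)"
    by (rule exp_ge_add_one_self)
  finally show ?thesis .
qed

lemma bern_sqrt_ratio_sum_le_1:
  assumes "p \<in> {0..1}" "q \<in> {0..1}"
  shows "(\<Sum>b\<in>UNIV. bern q b * (sqrt (bern p b / bern q b) * exp ((p - q)\<^sup>2 / 4))) \<le> 1"
proof -
  \<comment> \<open>The weight \<open>x\<close> absorbs the default value of \<open>y / 0\<close>:
    an outcome of probability zero under \<open>q\<close> contributes nothing on either
    side.\<close>
  have "x * sqrt (y / x) = sqrt (y * x)" if "x \<ge> 0" for x y :: real
    using that by (cases "x = 0") (auto simp: real_sqrt_mult real_sqrt_divide field_simps)
  then have "bern q b * sqrt (bern p b / bern q b) = sqrt (bern p b * bern q b)" for b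
    using bern_nonneg[OF assms(2)] by blast
  then have "(\<Sum>b\<in>UNIV. bern q b * (sqrt (bern p b / bern q b) * exp ((p - q)\<^sup>2 / 4)))
      = (sqrt (p * q) + sqrt ((1 - p) * (1 - q))) * exp ((p - q)\<^sup>2 / 4)"
    by (simp add: UNIV_bool mult.assoc[symmetric] distrib_right) (simp add: bern_def)
  also have "\<dots> \<le> exp (- (p - q)\<^sup>2 / 4) * exp ((p - q)\<^sup>2 / 4)"
    by (intro mult_right_mono hellinger_affinity_le assms) auto
  also have "\<dots> = 1"
    by (simp add: exp_add[symmetric])
  finally show ?thesis .
qed

section \<open>The law of one observation\<close>

context hub_model
begin

text \<open>The variables that the model declares independent. Restricting the edges to the nodes
  makes them an element of the finite set \<open>{1..n} \<rightarrow>\<^sub>E UNIV\<close>.\<close>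

definition obs :: "nat \<Rightarrow> 'a \<Rightarrow> nat \<times> (nat \<Rightarrow> bool)" where
  "obs t \<omega> = (Z t \<omega>, \<lambda>j\<in>{1..n}. G t j \<omega>)"

lemma indep_obs: "indep_vars (\<lambda>_. count_space UNIV) obs {1..T}"
  using indep_observations by (simp add: obs_def[abs_def])

lemma measurable_obs [measurable]: "t \<in> {1..T} \<Longrightarrow> obs t \<in> measurable M (count_space UNIV)"
  using indep_obs by (auto simp: indep_vars_def)

lemma measurable_Z: "t \<in> {1..T} \<Longrightarrow> Z t \<in> measurable M (count_space UNIV)"
  using measurable_compose[OF measurable_obs, of t fst "count_space UNIV"] by (simp add: obs_def)

lemma measurable_G:
  assumes "t \<in> {1..T}" "j \<in> {1..n}"
  shows "G t j \<in> measurable M (count_space UNIV)"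
  using measurable_compose[OF measurable_obs, of t "\<lambda>w. snd w j" "count_space UNIV"] assms
  by (simp add: obs_def)

lemma pred_Z [measurable]: "t \<in> {1..T} \<Longrightarrow> Measurable.pred M (\<lambda>\<omega>. Z t \<omega> = i)"
  using measurable_compose[OF measurable_Z, of t "\<lambda>z. z = i" "count_space UNIV"] by simp

lemma pred_G [measurable]: "t \<in> {1..T} \<Longrightarrow> j \<in> {1..n} \<Longrightarrow> Measurable.pred M (\<lambda>\<omega>. G t j \<omega>)"
  using measurable_G[of t j] by simp

lemma prob_label_marginal:
  assumes t: "t \<in> {1..T}" and i: "i \<in> {0..nL}" "0 < \<rho> i" and j: "j \<in> {1..n}"
  shows "prob {\<omega>\<in>space M. G t j \<omega> = b \<and> Z t \<omega> = i} = \<rho> i * bern (A i j) b"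
proof -
  have true: "prob {\<omega>\<in>space M. G t j \<omega> \<and> Z t \<omega> = i} = \<rho> i * A i j"
    using cond_marginal[OF t i j] label_prob[OF t i(1)] i(2) by (simp add: cond_prob_def field_simps)
  note [measurable] = pred_Z[OF t] pred_G[OF t j]
  have "prob {\<omega>\<in>space M. Z t \<omega> = i} = 
      prob {\<omega>\<in>space M. G t j \<omega> \<and> Z t \<omega> = i} + prob {\<omega>\<in>space M. \<not> G t j \<omega> \<and> Z t \<omega> = i}"
    by (subst finite_measure_Union[symmetric]) (auto intro!: arg_cong[where f = prob])
  with true show ?thesis
    using label_prob[OF t i(1)] by (cases b) (auto simp: bern_def algebra_simps)
qed

lemma prob_obs:
  assumes t: "t \<in> {1..T}" and i: "i \<in> {0..nL}" "0 < \<rho> i" and g: "g \<in> {1..n} \<rightarrow>\<^sub>E UNIV"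
  shows "prob {\<omega>\<in>space M. obs t \<omega> = (i, g)} = \<rho> i * (\<Prod>j=1..n. bern (A i j) (g j))"
proof -
  have "cond_prob M (\<lambda>\<omega>. G t j \<omega> = g j) (\<lambda>\<omega>. Z t \<omega> = i) = bern (A i j) (g j)" if "j \<in> {1..n}" for j
    using prob_label_marginal[OF t i that, of "g j"] label_prob[OF t i(1)] i(2)
    by (simp add: cond_prob_def)
  then have "cond_prob M (\<lambda>\<omega>. \<forall>j\<in>{1..n}. G t j \<omega> = g j) (\<lambda>\<omega>. Z t \<omega> = i) =
      (\<Prod>j=1..n. bern (A i j) (g j))"
    unfolding cond_indep[OF t i] by (intro prod.cong refl)
  moreover have "obs t \<omega> = (i, g) \<longleftrightarrow> (\<forall>j\<in>{1..n}. G t j \<omega> = g j) \<and> Z t \<omega> = i" for \<omega>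
    using g by (auto simp: obs_def fun_eq_iff restrict_def PiE_def extensional_def)
  ultimately show ?thesis
    using label_prob[OF t i(1)] i(2) by (simp add: cond_prob_def field_simps)
qed

text \<open>The label probabilities on \<open>{0..nL}\<close> already sum to one, which leaves no
  mass for any other value of \<open>Z t\<close>.\<close>

lemma AE_label: "t \<in> {1..T} \<Longrightarrow> AE \<omega> in M. Z t \<omega> \<in> {0..nL}"
proof -
  assume t: "t \<in> {1..T}"
  note [measurable] = pred_Z[OF t]
  have "prob (\<Union>i\<in>{0..nL}. {\<omega>\<in>space M. Z t \<omega> = i}) = (\<Sum>i=0..nL. prob {\<omega>\<in>space M. Z t \<omega> = i})"
    by (intro finite_measure_finite_Union) (auto simp: disjoint_family_on_def)
  also have "\<dots> = 1"
    using label_prob[OF t] rho_sum by simp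
  also have "(\<Union>i\<in>{0..nL}. {\<omega>\<in>space M. Z t \<omega> = i}) = {\<omega>\<in>space M. Z t \<omega> \<in> {0..nL}}"
    by auto
  finally show ?thesis
    using measurable_Z[OF t] by (subst (asm) prob_Collect_eq_1) auto
qed

text \<open>There are finitely many pairs of a label and an edge value, and each pair of likelihood
  zero has probability zero. Hence \<open>ln 0\<close> almost surely does not occur in the true
  log-likelihood.\<close>

lemma AE_bern_pos:
  assumes rho_pos: "\<And>i. i \<in> {0..nL} \<Longrightarrow> 0 < \<rho> i" and t: "t \<in> {1..T}" and j: "j \<in> {1..n}"
  shows "AE \<omega> in M. 0 < bern (A (Z t \<omega>) j) (G t j \<omega>)"
proof -
  note [measurable] = pred_Z[OF t] pred_G[OF t j]
  have "AE \<omega> in M. \<forall>i\<in>{0..nL}. \<forall>b\<in>UNIV. bern (A i j) b \<le> 0 \<longrightarrow> \<not> (G t j \<omega> = b \<and> Z t \<omega> = i)"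
  proof (intro AE_finite_allI AE_impI)
    fix i b assume i: "i \<in> {0..nL}" and "bern (A i j) b \<le> 0"
    then have "bern (A i j) b = 0" using bern_nonneg[OF A_range[OF i j], of b] by simp
    then have "prob {\<omega>\<in>space M. G t j \<omega> = b \<and> Z t \<omega> = i} = 0"
      using prob_label_marginal[OF t i rho_pos[OF i] j] by simp
    then show "AE \<omega> in M. \<not> (G t j \<omega> = b \<and> Z t \<omega> = i)"
      by (subst (asm) prob_Collect_eq_0) auto
  qed auto
  with AE_label[OF t] show ?thesis by eventually_elim (blast intro: leI)
qed

text \<open>The variable is a finite combination of indicators of the values of
  \<open>obs t\<close>. Because \<open>h\<close> vanishes at labels out of range, this
  representation holds at every outcome and not only almost surely.\<close>

lemma expectation_obs:
  fixes h :: "nat \<Rightarrow> (nat \<Rightarrow> bool) \<Rightarrow> real"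
  assumes rho_pos: "\<And>i. i \<in> {0..nL} \<Longrightarrow> 0 < \<rho> i" and t: "t \<in> {1..T}"
    and h: "\<And>i g. i \<notin> {0..nL} \<Longrightarrow> h i g = 0"
  shows "integrable M (\<lambda>\<omega>. case_prod h (obs t \<omega>))"
    and "expectation (\<lambda>\<omega>. case_prod h (obs t \<omega>)) =
      (\<Sum>i=0..nL. \<rho> i * (\<Sum>g\<in>{1..n} \<rightarrow>\<^sub>E UNIV. (\<Prod>j=1..n. bern (A i j) (g j)) * h i g))"
proof -
  define S where "S = {0..nL} \<times> ({1..n} \<rightarrow>\<^sub>E (UNIV :: bool set))"
  have S: "finite S" unfolding S_def by (intro finite_cartesian_product finite_PiE) auto
  have [measurable]: "{\<omega>\<in>space M. obs t \<omega> = w} \<in> sets M" for w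
    using measurable_compose[OF measurable_obs[OF t], of "\<lambda>x. x = w" "count_space UNIV"] by simp
  have eq: "case_prod h (obs t \<omega>) =
      (\<Sum>w\<in>S. case_prod h w * indicator {\<omega>\<in>space M. obs t \<omega> = w} \<omega>)" if "\<omega> \<in> space M" for \<omega>
  proof -
    have "(\<Sum>w\<in>S. case_prod h w * indicator {\<omega>\<in>space M. obs t \<omega> = w} \<omega>) =
        (\<Sum>w\<in>S. if obs t \<omega> = w then case_prod h w else 0)"
      using that by (intro sum.cong) (auto simp: indicator_def)
    also have "\<dots> = (if obs t \<omega> \<in> S then case_prod h (obs t \<omega>) else 0)"
      using S by (simp add: sum.delta)
    also have "\<dots> = case_prod h (obs t \<omega>)"
      using h by (auto simp: S_def obs_def)
    finally show ?thesis by simp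
  qed
  have ind: "integrable M (\<lambda>\<omega>. case_prod h w * indicator {\<omega>\<in>space M. obs t \<omega> = w} \<omega>)" for w
    by (intro integrable_mult_right integrable_real_indicator) (auto simp: emeasure_eq_measure)
  show "integrable M (\<lambda>\<omega>. case_prod h (obs t \<omega>))"
    by (subst Bochner_Integration.integrable_cong[OF refl eq], assumption)
      (intro Bochner_Integration.integrable_sum ind)
  have "expectation (\<lambda>\<omega>. case_prod h (obs t \<omega>)) =
      (\<Sum>w\<in>S. case_prod h w * prob {\<omega>\<in>space M. obs t \<omega> = w})"
  proof -
    have "expectation (\<lambda>\<omega>. case_prod h (obs t \<omega>)) =
        (\<Sum>w\<in>S. expectation (\<lambda>\<omega>. case_prod h w * indicator {\<omega>\<in>space M. obs t \<omega> = w} \<omega>))"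
      using Bochner_Integration.integral_sum[OF ind, where I = S]
      by (simp only: Bochner_Integration.integral_cong[OF refl eq])
    then show ?thesis
      by (simp add: Int_absorb2)
  qed
  also have "\<dots> = (\<Sum>(i, g)\<in>S. \<rho> i * ((\<Prod>j=1..n. bern (A i j) (g j)) * h i g))"
  proof (intro sum.cong refl)
    fix w assume "w \<in> S"
    then obtain i g where w: "w = (i, g)" "i \<in> {0..nL}" "g \<in> {1..n} \<rightarrow>\<^sub>E UNIV"
      unfolding S_def by blast
    then show "case_prod h w * prob {\<omega>\<in>space M. obs t \<omega> = w} =
        (case w of (i, g) \<Rightarrow> \<rho> i * ((\<Prod>j=1..n. bern (A i j) (g j)) * h i g))"
      using prob_obs[OF t w(2) rho_pos[OF w(2)] w(3)] by simp
  qed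
  also have "\<dots> = (\<Sum>i=0..nL. \<rho> i * (\<Sum>g\<in>{1..n} \<rightarrow>\<^sub>E UNIV. (\<Prod>j=1..n. bern (A i j) (g j)) * h i g))"
    unfolding S_def sum.cartesian_product[symmetric] sum_distrib_left ..
  finally show "expectation (\<lambda>\<omega>. case_prod h (obs t \<omega>)) =
      (\<Sum>i=0..nL. \<rho> i * (\<Sum>g\<in>{1..n} \<rightarrow>\<^sub>E UNIV. (\<Prod>j=1..n. bern (A i j) (g j)) * h i g))" .
qed

end

section \<open>The profile likelihood\<close>

lemma A_hat_eq:
  "A_hat T g z i j = real (card {t\<in>{1..T}. z t = i \<and> g t j}) / real (card {t\<in>{1..T}. z t = i})"
proof -
  have "(\<Sum>t = 1..T. of_bool (g t j) * of_bool (z t = i)) = real (card {t\<in>{1..T}. z t = i \<and> g t j})"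
    by (simp add: of_bool_conj[symmetric] conj_commute Int_def sum_of_bool_eq)
  then show ?thesis by (simp add: A_hat_def group_size_def)
qed

lemma A_hat_range: "A_hat T g z i j \<in> {0..1}"
proof -
  have "card {t\<in>{1..T}. z t = i \<and> g t j} \<le> card {t\<in>{1..T}. z t = i}"
    by (intro card_mono) auto
  then show ?thesis by (auto simp: A_hat_eq divide_le_eq_1)
qed

text \<open>Observation \<open>t\<close> is itself counted in group \<open>z t\<close>, so its value
  at node \<open>j\<close> has positive frequency there.\<close>

lemma bern_A_hat_pos:
  assumes "t \<in> {1..T}"
  shows "0 < bern (A_hat T g z (z t) j) (g t j)"
proof -
  let ?S = "{s\<in>{1..T}. z s = z t}" and ?R = "{s\<in>{1..T}. z s = z t \<and> g s j}"
  have S: "0 < card ?S" using assms by (auto simp: card_gt_0_iff)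
  show ?thesis
  proof (cases "g t j")
    case True
    then have "0 < card ?R" using assms by (auto simp: card_gt_0_iff)
    with S True show ?thesis by (simp add: bern_def A_hat_eq)
  next
    case False
    then have "card ?R < card ?S" using assms by (intro psubset_card_mono) auto
    with S False show ?thesis by (simp add: bern_def A_hat_eq)
  qed
qed

lemma profile_loglik_bern:
  "profile_loglik n T g z = (\<Sum>t=1..T. \<Sum>j=1..n. ln (bern (A_hat T g z (z t) j) (g t j)))"
  unfolding profile_loglik_def by (intro sum.cong refl) (simp add: bern_def)

text \<open>With \<open>q\<close> the empirical frequency, the sum is \<open>card S\<close> times
  \<open>q * (p / q) + (1 - q) * ((1 - p) / (1 - q))\<close>. This is \<open>1\<close> unless
  \<open>q\<close> is \<open>0\<close> or \<open>1\<close>; then one of the two terms vanishes and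
  an inequality remains.\<close>

lemma sum_bern_ratio_le_card:
  assumes S: "finite S" and p: "p \<in> {0..1}"
  shows "(\<Sum>t\<in>S. bern p (b t) / bern (real (card {t\<in>S. b t}) / real (card S)) (b t)) \<le> real (card S)"
proof (cases "S = {}")
  case False
  define q where "q = real (card {t\<in>S. b t}) / real (card S)"
  have N: "0 < real (card S)" using S False by (simp add: card_gt_0_iff)
  have card: "card {t\<in>S. b t} + card {t\<in>S. \<not> b t} = card S"
    using S by (subst card_Un_disjoint[symmetric]) (auto intro!: arg_cong[where f = card])
  then have "real (card {t\<in>S. b t}) + real (card {t\<in>S. \<not> b t}) = real (card S)"
    by (simp flip: of_nat_add)
  moreover have q1: "real (card {t\<in>S. b t}) = q * card S"
    using N by (simp add: q_def)
  ultimately have q2: "real (card {t\<in>S. \<not> b t}) = (1 - q) * card S"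
    by (simp add: algebra_simps)
  have le: "x * (y / x) \<le> y" if "0 \<le> y" for x y :: real
    using that by (cases "x = 0") auto
  have "(\<Sum>t\<in>S. bern p (b t) / bern q (b t)) =
      (\<Sum>t\<in>{t\<in>S. b t}. p / q) + (\<Sum>t\<in>{t\<in>S. \<not> b t}. (1 - p) / (1 - q))"
    using sum.If_cases[OF S, of b "\<lambda>_. p / q" "\<lambda>_. (1 - p) / (1 - q)"]
    by (simp add: bern_def Int_def if_distrib cong: if_cong)
  also have "\<dots> = (q * (p / q) + (1 - q) * ((1 - p) / (1 - q))) * card S"
    unfolding sum_constant q1 q2 by (simp only: distrib_left mult_ac)
  also have "\<dots> \<le> (p + (1 - p)) * card S"
    using p by (intro mult_right_mono add_mono le) auto
  finally show ?thesis by (simp add: q_def)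
qed simp

text \<open>Gibbs' inequality within each group.\<close>

lemma loglik_le_profile_loglik:
  assumes B: "\<And>t j. t \<in> {1..T} \<Longrightarrow> j \<in> {1..n} \<Longrightarrow> B (z t) j \<in> {0..1}"
    and pos: "\<And>t j. t \<in> {1..T} \<Longrightarrow> j \<in> {1..n} \<Longrightarrow> 0 < bern (B (z t) j) (g t j)"
  shows "(\<Sum>t=1..T. \<Sum>j=1..n. ln (bern (B (z t) j) (g t j))) \<le> profile_loglik n T g z"
proof -
  define r where "r t j = bern (B (z t) j) (g t j) / bern (A_hat T g z (z t) j) (g t j)" for t j
  \<comment> \<open>Since \<open>ln r \<le> r - 1\<close>, it is enough that the likelihood ratios
    of each node sum to at most \<open>T\<close>.\<close>
  have column: "(\<Sum>t=1..T. r t j) \<le> real T" if j: "j \<in> {1..n}" for j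
  proof -
    have "(\<Sum>t=1..T. r t j) = (\<Sum>i\<in>z ` {1..T}. \<Sum>t\<in>{t\<in>{1..T}. z t = i}. r t j)"
      by (intro sum.image_gen) simp
    also have "\<dots> \<le> (\<Sum>i\<in>z ` {1..T}. real (card {t\<in>{1..T}. z t = i}))"
    proof (intro sum_mono)
      fix i assume "i \<in> z ` {1..T}"
      then have "B i j \<in> {0..1}" using B j by blast
      from sum_bern_ratio_le_card[OF _ this, of "{t\<in>{1..T}. z t = i}" "\<lambda>t. g t j"]
      show "(\<Sum>t\<in>{t\<in>{1..T}. z t = i}. r t j) \<le> real (card {t\<in>{1..T}. z t = i})"
        by (simp add: r_def A_hat_eq conj_assoc)
    qed
    also have "\<dots> = (\<Sum>i\<in>z ` {1..T}. \<Sum>t\<in>{t\<in>{1..T}. z t = i}. 1)"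
      by simp
    also have "\<dots> = (\<Sum>t=1..T. 1)"
      by (intro sum.image_gen[symmetric]) simp
    finally show ?thesis by simp
  qed
  have "(\<Sum>t=1..T. \<Sum>j=1..n. ln (bern (B (z t) j) (g t j))) - profile_loglik n T g z =
      (\<Sum>t=1..T. \<Sum>j=1..n. ln (r t j))"
    unfolding profile_loglik_bern sum_subtractf[symmetric] r_def
    by (intro sum.cong refl ln_divide_pos[symmetric] pos bern_A_hat_pos)
  also have "\<dots> \<le> (\<Sum>t=1..T. \<Sum>j=1..n. r t j - 1)"
    using pos bern_A_hat_pos[of _ T g z] by (intro sum_mono ln_le_minus_one) (simp add: r_def)
  also have "\<dots> = (\<Sum>j=1..n. (\<Sum>t=1..T. r t j) - real T)"
    by (subst sum.swap) (simp add: sum_subtractf)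
  also have "\<dots> \<le> 0"
    using column by (intro sum_nonpos) simp
  finally show ?thesis by simp
qed

section \<open>Squared error of the maximiser\<close>

context hub_model
begin

text \<open>The almost sure event on which the true labels are a valid competitor and every
  logarithm in the true log-likelihood has a positive argument.\<close>

definition regular :: "'a \<Rightarrow> bool" where
  "regular \<omega> \<longleftrightarrow> (\<forall>t\<in>{1..T}. Z t \<omega> \<in> {0..nL} \<and> (\<forall>j\<in>{1..n}. 0 < bern (A (Z t \<omega>) j) (G t j \<omega>)))"

lemma AE_regular:
  assumes "\<And>i. i \<in> {0..nL} \<Longrightarrow> 0 < \<rho> i"
  shows "AE \<omega> in M. regular \<omega>"
  unfolding regular_def using assms
  by (intro AE_finite_allI AE_conjI AE_label AE_bern_pos) auto

text \<open>As \<open>A i i = 1\<close>, a missing hub would have likelihood zero, which regularity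
  excludes.\<close>

lemma feasible_labels:
  assumes "regular \<omega>"
  shows "feasible nL T (\<lambda>t j. G t j \<omega>) (\<lambda>t. Z t \<omega>)"
  unfolding feasible_def
proof (intro ballI conjI)
  fix t assume t: "t \<in> {1..T}"
  show Z: "Z t \<omega> \<in> {0..nL}" using assms t by (simp add: regular_def)
  show "Z t \<omega> = 0 \<or> G t (Z t \<omega>) \<omega>"
  proof (cases "Z t \<omega> = 0")
    case False
    then have "Z t \<omega> \<in> {1..nL}" "Z t \<omega> \<in> {1..n}" using Z nL_le_n by auto
    then have "0 < bern 1 (G t (Z t \<omega>) \<omega>)"
      using assms t A_diag by (metis regular_def)
    then show ?thesis by (auto simp: bern_def split: if_splits)
  qed simp
qed

text \<open>Replacing \<open>A\<close> by the frequencies of the true classes can only increase the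
  likelihood, and the true labels are feasible, so the maximiser does at least as well.\<close>

lemma mle_loglik_ge:
  assumes "regular \<omega>" and mle: "profile_mle nL n T (\<lambda>t j. G t j \<omega>) z"
  shows "(\<Sum>t=1..T. \<Sum>j=1..n. ln (bern (A (Z t \<omega>) j) (G t j \<omega>)))
    \<le> (\<Sum>t=1..T. \<Sum>j=1..n. ln (bern (A_hat T (\<lambda>t j. G t j \<omega>) z (z t) j) (G t j \<omega>)))"
proof -
  have "(\<Sum>t=1..T. \<Sum>j=1..n. ln (bern (A (Z t \<omega>) j) (G t j \<omega>)))
      \<le> profile_loglik n T (\<lambda>t j. G t j \<omega>) (\<lambda>t. Z t \<omega>)"
    using assms(1) A_range by (intro loglik_le_profile_loglik) (auto simp: regular_def)
  also have "\<dots> \<le> profile_loglik n T (\<lambda>t j. G t j \<omega>) z"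
    using mle feasible_labels[OF assms(1)] by (auto simp: profile_mle_def is_arg_max_def not_less)
  finally show ?thesis by (simp add: profile_loglik_bern)
qed

text \<open>
  The square root of a likelihood ratio, tilted by its squared \<open>L\<^sup>2\<close> distance. The Hellinger
  affinity bound keeps the mean at most \<open>1\<close>, and no logarithm of a small probability occurs.
\<close>

definition tilted_ratio :: "(nat \<Rightarrow> real) \<Rightarrow> nat \<Rightarrow> (nat \<Rightarrow> bool) \<Rightarrow> real" where
  "tilted_ratio b i g = (if i \<in> {0..nL} then
     \<Prod>j=1..n. sqrt (bern (b j) (g j) / bern (A i j) (g j)) * exp ((b j - A i j)\<^sup>2 / 4) else 0)"

text \<open>Given the label the edges are independent, so the sum over edge vectors factorises over
  the nodes. Each factor is at most \<open>1\<close> by the affinity bound, and averaging over the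
  label preserves this.\<close>

lemma expectation_tilted_ratio:
  assumes rho_pos: "\<And>i. i \<in> {0..nL} \<Longrightarrow> 0 < \<rho> i" and t: "t \<in> {1..T}"
    and b: "\<And>j. j \<in> {1..n} \<Longrightarrow> b j \<in> {0..1}"
  shows "expectation (\<lambda>\<omega>. case_prod (tilted_ratio b) (obs t \<omega>)) \<le> 1"
proof -
  have inner: "(\<Sum>g\<in>{1..n} \<rightarrow>\<^sub>E UNIV. (\<Prod>j=1..n. bern (A i j) (g j)) * tilted_ratio b i g) \<le> 1"
    if i: "i \<in> {0..nL}" for i
  proof -
    let ?f = "\<lambda>j y. bern (A i j) y * (sqrt (bern (b j) y / bern (A i j) y) * exp ((b j - A i j)\<^sup>2 / 4))"
    have "(\<Sum>g\<in>{1..n} \<rightarrow>\<^sub>E UNIV. (\<Prod>j=1..n. bern (A i j) (g j)) * tilted_ratio b i g) =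
        (\<Sum>g\<in>{1..n} \<rightarrow>\<^sub>E UNIV. \<Prod>j=1..n. ?f j (g j))"
      using i by (simp only: tilted_ratio_def prod.distrib if_True)
    also have "\<dots> = (\<Prod>j=1..n. \<Sum>y\<in>UNIV. ?f j y)"
      by (intro prod_sum_PiE[symmetric]) auto
    also have "\<dots> \<le> (\<Prod>j=1..n. 1)"
    proof (intro prod_mono conjI)
      fix j assume j: "j \<in> {1..n}"
      show "0 \<le> (\<Sum>y\<in>UNIV. ?f j y)"
        by (intro sum_nonneg mult_nonneg_nonneg bern_nonneg A_range i j real_sqrt_ge_zero
            divide_nonneg_nonneg b) auto
      show "(\<Sum>y\<in>UNIV. ?f j y) \<le> 1"
        by (intro bern_sqrt_ratio_sum_le_1 A_range b i j)
    qed
    finally show ?thesis by simp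
  qed
  have "expectation (\<lambda>\<omega>. case_prod (tilted_ratio b) (obs t \<omega>)) =
      (\<Sum>i=0..nL. \<rho> i * (\<Sum>g\<in>{1..n} \<rightarrow>\<^sub>E UNIV. (\<Prod>j=1..n. bern (A i j) (g j)) * tilted_ratio b i g))"
    by (intro expectation_obs rho_pos t) (simp_all add: tilted_ratio_def)
  also have "\<dots> \<le> (\<Sum>i=0..nL. \<rho> i * 1)"
    by (intro sum_mono mult_left_mono inner rho_nonneg)
  finally show ?thesis using rho_sum by simp
qed

lemma tilted_ratio_nonneg: "(\<And>j. j \<in> {1..n} \<Longrightarrow> b j \<in> {0..1}) \<Longrightarrow> 0 \<le> tilted_ratio b i g"
  unfolding tilted_ratio_def
  by (auto intro!: prod_nonneg mult_nonneg_nonneg real_sqrt_ge_zero divide_nonneg_nonneg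
      bern_nonneg A_range simp del: atLeastAtMost_iff)

text \<open>The array \<open>b\<close> is fixed here and does not depend on the outcome. The
  estimated array does, and is reached by a union bound over its possible values.\<close>

lemma prob_tilted_ratio_ge:
  assumes rho_pos: "\<And>i. i \<in> {0..nL} \<Longrightarrow> 0 < \<rho> i"
    and b: "\<And>t j. t \<in> {1..T} \<Longrightarrow> j \<in> {1..n} \<Longrightarrow> b t j \<in> {0..1}" and a: "0 < a"
  shows "prob {\<omega>\<in>space M. a \<le> (\<Prod>t=1..T. case_prod (tilted_ratio (b t)) (obs t \<omega>))} \<le> 1 / a"
proof -
  have "prob {\<omega>\<in>space M. a \<le> (\<Prod>t=1..T. case_prod (tilted_ratio (b t)) (obs t \<omega>))}
      \<le> (\<Prod>t=1..T. 1) / a"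
  proof (intro prob_prod_ge expectation_tilted_ratio expectation_obs(1) rho_pos b a)
    show "indep_vars (\<lambda>_. borel) (\<lambda>t \<omega>. case_prod (tilted_ratio (b t)) (obs t \<omega>)) {1..T}"
      by (rule indep_vars_compose2[OF indep_obs]) simp
    show "0 \<le> case_prod (tilted_ratio (b t)) (obs t \<omega>)" if "t \<in> {1..T}" for t \<omega>
      using tilted_ratio_nonneg[OF b[OF that]] by (simp split: prod.split)
  qed (auto simp: tilted_ratio_def)
  then show ?thesis by simp
qed

lemma prod_tilted_ratio:
  assumes reg: "regular \<omega>"
    and pos: "\<And>t j. t \<in> {1..T} \<Longrightarrow> j \<in> {1..n} \<Longrightarrow> 0 < bern (b t j) (G t j \<omega>)"
  shows "(\<Prod>t=1..T. case_prod (tilted_ratio (b t)) (obs t \<omega>)) =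
    exp (((\<Sum>t=1..T. \<Sum>j=1..n. ln (bern (b t j) (G t j \<omega>)))
       - (\<Sum>t=1..T. \<Sum>j=1..n. ln (bern (A (Z t \<omega>) j) (G t j \<omega>)))) / 2
       + (\<Sum>t=1..T. \<Sum>j=1..n. (b t j - A (Z t \<omega>) j)\<^sup>2) / 4)"
proof -
  have factor: "sqrt (bern (b t j) (G t j \<omega>) / bern (A (Z t \<omega>) j) (G t j \<omega>)) * exp ((b t j - A (Z t \<omega>) j)\<^sup>2 / 4) =
      exp ((ln (bern (b t j) (G t j \<omega>)) - ln (bern (A (Z t \<omega>) j) (G t j \<omega>))) / 2 + (b t j - A (Z t \<omega>) j)\<^sup>2 / 4)"
    if "t \<in> {1..T}" "j \<in> {1..n}" for t j
  proof -
    have half: "exp ((ln x - ln y) / 2) = sqrt (x / y)" if "0 < x" "0 < y" for x y :: real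
    proof -
      have "sqrt (x / y) = exp (ln (sqrt (x / y)))" using that by simp
      also have "ln (sqrt (x / y)) = (ln x - ln y) / 2"
        using that by (simp add: ln_sqrt ln_divide_pos)
      finally show ?thesis ..
    qed
    have "0 < bern (A (Z t \<omega>) j) (G t j \<omega>)" using reg that by (simp add: regular_def)
    from half[OF pos[OF that] this] have "exp ((ln (bern (b t j) (G t j \<omega>)) - ln (bern (A (Z t \<omega>) j) (G t j \<omega>))) / 2) =
        sqrt (bern (b t j) (G t j \<omega>) / bern (A (Z t \<omega>) j) (G t j \<omega>))" .
    then show ?thesis by (simp add: exp_add)
  qed
  have "case_prod (tilted_ratio (b t)) (obs t \<omega>) =
      (\<Prod>j=1..n. exp ((ln (bern (b t j) (G t j \<omega>)) - ln (bern (A (Z t \<omega>) j) (G t j \<omega>))) / 2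
        + (b t j - A (Z t \<omega>) j)\<^sup>2 / 4))" if t: "t \<in> {1..T}" for t
  proof -
    have "Z t \<omega> \<in> {0..nL}" using reg t by (simp add: regular_def)
    then have "case_prod (tilted_ratio (b t)) (obs t \<omega>) =
        (\<Prod>j=1..n. sqrt (bern (b t j) (G t j \<omega>) / bern (A (Z t \<omega>) j) (G t j \<omega>)) * exp ((b t j - A (Z t \<omega>) j)\<^sup>2 / 4))"
      by (auto simp: obs_def tilted_ratio_def intro!: prod.cong)
    also have "\<dots> = (\<Prod>j=1..n. exp ((ln (bern (b t j) (G t j \<omega>)) - ln (bern (A (Z t \<omega>) j) (G t j \<omega>))) / 2
        + (b t j - A (Z t \<omega>) j)\<^sup>2 / 4))"
      by (intro prod.cong refl factor t)
    finally show ?thesis .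
  qed
  then have "(\<Prod>t=1..T. case_prod (tilted_ratio (b t)) (obs t \<omega>)) =
      exp (\<Sum>t=1..T. \<Sum>j=1..n. (ln (bern (b t j) (G t j \<omega>)) - ln (bern (A (Z t \<omega>) j) (G t j \<omega>))) / 2
        + (b t j - A (Z t \<omega>) j)\<^sup>2 / 4)"
    by (simp add: exp_sum)
  then show ?thesis
    by (simp add: sum.distrib sum_subtractf sum_divide_distrib[symmetric])
qed

lemma mle_squared_error:
  fixes s :: real
  assumes rho_pos: "\<And>i. i \<in> {0..nL} \<Longrightarrow> 0 < \<rho> i"
  shows "\<exists>E\<in>sets M. prob E \<le> real ((nL + 1) ^ T * (T + 1) ^ ((nL + 1) * n)) / exp s \<and>
    (\<forall>\<omega>\<in>space M - E. regular \<omega> \<longrightarrow> (\<forall>z. profile_mle nL n T (\<lambda>t j. G t j \<omega>) z \<longrightarrow>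
       (\<Sum>t=1..T. \<Sum>j=1..n. (A_hat T (\<lambda>t j. G t j \<omega>) z (z t) j - A (Z t \<omega>) j)\<^sup>2) \<le> 4 * s))"
proof -
  define \<Theta> where "\<Theta> = ({1..T} \<rightarrow>\<^sub>E {0..nL}) \<times> ({0..nL} \<times> {1..n} \<rightarrow>\<^sub>E {0..T})"
  \<comment> \<open>The cap at \<open>1\<close> keeps the entries in the unit interval for tables
    that no data produce. For tables of actual counts it has no effect.\<close>
  define B where "B = (\<lambda>(z :: nat \<Rightarrow> nat, m :: nat \<times> nat \<Rightarrow> nat) t j. min 1 (real (m (z t, j)) / real (card {s\<in>{1..T}. z s = z t})))"
  define E where "E \<theta> = {\<omega>\<in>space M. exp s \<le> (\<Prod>t=1..T. case_prod (tilted_ratio (B \<theta> t)) (obs t \<omega>))}" for \<theta>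
  have fin: "finite \<Theta>" unfolding \<Theta>_def by (intro finite_cartesian_product finite_PiE) auto
  have card: "card \<Theta> = (nL + 1) ^ T * (T + 1) ^ ((nL + 1) * n)"
    by (simp add: \<Theta>_def card_cartesian_product card_PiE)
  have sets: "E \<theta> \<in> sets M" for \<theta>
  proof -
    have [measurable]: "(\<lambda>\<omega>. case_prod (tilted_ratio (B \<theta> t)) (obs t \<omega>)) \<in> borel_measurable M"
      if "t \<in> {1..T}" for t
      using measurable_compose[OF measurable_obs[OF that], of "case_prod (tilted_ratio (B \<theta> t))" borel] by simp
    show ?thesis unfolding E_def by measurable
  qed
  have "prob (\<Union>\<theta>\<in>\<Theta>. E \<theta>) \<le> (\<Sum>\<theta>\<in>\<Theta>. prob (E \<theta>))"
    using sets by (intro finite_measure_subadditive_finite fin) auto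
  also have "\<dots> \<le> (\<Sum>\<theta>\<in>\<Theta>. 1 / exp s)"
    unfolding E_def by (intro sum_mono prob_tilted_ratio_ge rho_pos) (auto simp: B_def split: prod.split)
  also have "\<dots> = real ((nL + 1) ^ T * (T + 1) ^ ((nL + 1) * n)) / exp s"
    by (simp add: card)
  finally have "prob (\<Union>\<theta>\<in>\<Theta>. E \<theta>) \<le> real ((nL + 1) ^ T * (T + 1) ^ ((nL + 1) * n)) / exp s" .
  moreover have "(\<Sum>t=1..T. \<Sum>j=1..n. (A_hat T (\<lambda>t j. G t j \<omega>) z (z t) j - A (Z t \<omega>) j)\<^sup>2) \<le> 4 * s"
    if \<omega>: "\<omega> \<in> space M - (\<Union>\<theta>\<in>\<Theta>. E \<theta>)" and reg: "regular \<omega>"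
      and mle: "profile_mle nL n T (\<lambda>t j. G t j \<omega>) z" for \<omega> z
  proof -
    define b where "b t j = A_hat T (\<lambda>t j. G t j \<omega>) z (z t) j" for t j
    define m where "m = (\<lambda>(i, j). card {t\<in>{1..T}. z t = i \<and> G t j \<omega>})"
    define \<theta> where "\<theta> = (restrict z {1..T}, restrict m ({0..nL} \<times> {1..n}))"
    have z: "z t \<in> {0..nL}" if "t \<in> {1..T}" for t
      using mle that by (auto simp: profile_mle_def is_arg_max_def feasible_def)
    have "card {t\<in>{1..T}. z t = i \<and> G t j \<omega>} \<le> card {1..T}" for i j
      by (intro card_mono) auto
    then have "\<theta> \<in> \<Theta>"
      using z by (auto simp: \<theta>_def \<Theta>_def m_def simp del: atLeastAtMost_iff) (simp add: atLeastAtMost_iff)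
    with \<omega> have "(\<Prod>t=1..T. case_prod (tilted_ratio (B \<theta> t)) (obs t \<omega>)) < exp s"
      by (force simp: E_def not_le)
    also have "(\<Prod>t=1..T. case_prod (tilted_ratio (B \<theta> t)) (obs t \<omega>)) =
        (\<Prod>t=1..T. case_prod (tilted_ratio (b t)) (obs t \<omega>))"
    proof (intro prod.cong refl)
      fix t assume t: "t \<in> {1..T}"
      have "{s\<in>{1..T}. restrict z {1..T} s = z t} = {s\<in>{1..T}. z s = z t}" by auto
      then have "B \<theta> t j = b t j" if "j \<in> {1..n}" for j
        using t z[OF t] that A_hat_range[of T "\<lambda>t j. G t j \<omega>" z "z t" j]
        by (simp add: B_def \<theta>_def b_def m_def A_hat_eq)
      then have "tilted_ratio (B \<theta> t) i g = tilted_ratio (b t) i g" for i g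
        by (auto simp: tilted_ratio_def intro!: prod.cong)
      then show "case_prod (tilted_ratio (B \<theta> t)) (obs t \<omega>) = case_prod (tilted_ratio (b t)) (obs t \<omega>)"
        by (simp split: prod.split)
    qed
    also have "\<dots> = exp (((\<Sum>t=1..T. \<Sum>j=1..n. ln (bern (b t j) (G t j \<omega>)))
       - (\<Sum>t=1..T. \<Sum>j=1..n. ln (bern (A (Z t \<omega>) j) (G t j \<omega>)))) / 2
       + (\<Sum>t=1..T. \<Sum>j=1..n. (b t j - A (Z t \<omega>) j)\<^sup>2) / 4)"
      unfolding b_def by (intro prod_tilted_ratio reg bern_A_hat_pos)
    finally have "((\<Sum>t=1..T. \<Sum>j=1..n. ln (bern (b t j) (G t j \<omega>)))
       - (\<Sum>t=1..T. \<Sum>j=1..n. ln (bern (A (Z t \<omega>) j) (G t j \<omega>)))) / 2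
       + (\<Sum>t=1..T. \<Sum>j=1..n. (b t j - A (Z t \<omega>) j)\<^sup>2) / 4 < s"
      by simp
    moreover have "y \<le> 4 * s" if "x' \<le> x" "(x - x') / 2 + y / 4 < s" for x x' y :: real
    proof -
      have "0 \<le> (x - x') / 2" using that(1) by simp
      then have "y / 4 < s" using that(2) by linarith
      then show ?thesis by simp
    qed
    ultimately show ?thesis
      using mle_loglik_ge[OF reg mle] unfolding b_def by blast
  qed
  ultimately show ?thesis
    using sets fin by (intro bexI[of _ "\<Union>\<theta>\<in>\<Theta>. E \<theta>"] conjI ballI impI allI) auto
qed

end

section \<open>Concentration in the true classes\<close>

lemma (in prob_space) expectation_of_bool:
  "expectation (\<lambda>\<omega>. of_bool (P \<omega>)) = prob {\<omega>\<in>space M. P \<omega>}"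
proof -
  have "expectation (\<lambda>\<omega>. of_bool (P \<omega>)) = expectation (indicat_real {\<omega>\<in>space M. P \<omega>})"
    by (intro Bochner_Integration.integral_cong) (auto simp: indicator_def)
  then show ?thesis by (simp add: Int_absorb2)
qed

context hub_model
begin

lemma expectation_label: "t \<in> {1..T} \<Longrightarrow> i \<in> {0..nL} \<Longrightarrow>
  expectation (\<lambda>\<omega>. of_bool (Z t \<omega> = i)) = \<rho> i"
  by (simp only: expectation_of_bool label_prob)

lemma integrable_label: "t \<in> {1..T} \<Longrightarrow> integrable M (\<lambda>\<omega>. of_bool (Z t \<omega> = i) :: real)"
  using pred_Z[of t i] by (intro integrable_const_bound[where B = 1]) (auto simp: of_bool_def)

lemma prob_class_size:
  fixes l s :: real
  assumes i: "i \<in> {0..nL}" and l: "0 < l" "l \<le> 1"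
  shows "prob {\<omega>\<in>space M. s \<le> \<bar>\<Sum>t=1..T. of_bool (Z t \<omega> = i) - \<rho> i\<bar>} \<le> 2 * exp (l\<^sup>2 * T * \<rho> i - l * s)"
proof -
  have rho: "0 \<le> \<rho> i" "\<rho> i \<le> 1"
    using rho_nonneg i member_le_sum[of i "{0..nL}" \<rho>] rho_sum by auto
  have "prob {\<omega>\<in>space M. s \<le> \<bar>\<Sum>t\<in>{1..T}. of_bool (Z t \<omega> = i) - \<rho> i\<bar>} \<le> 2 * exp (l\<^sup>2 * card {1..T} * \<rho> i - l * s)"
  proof (intro prob_abs_sum_ge l)
    show "indep_vars (\<lambda>_. borel) (\<lambda>t \<omega>. of_bool (Z t \<omega> = i) - \<rho> i) {1..T}"
      using indep_vars_compose2[OF indep_obs, of "\<lambda>_ w. of_bool (fst w = i) - \<rho> i" "\<lambda>_. borel"]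
      by (simp add: obs_def)
  next
    fix t assume t: "t \<in> {1..T}"
    note int = integrable_label[OF t, of i] and E = expectation_label[OF t i]
    show "\<bar>of_bool (Z t \<omega> = i) - \<rho> i\<bar> \<le> 1" for \<omega>
      using rho by (auto simp: of_bool_def)
    show "expectation (\<lambda>\<omega>. of_bool (Z t \<omega> = i) - \<rho> i) = 0"
      using int E by (simp add: prob_space)
    \<comment> \<open>An indicator is its own square, so the centred square is affine in the
      indicator and its mean is the variance \<open>\<rho> i - (\<rho> i)^2\<close>.\<close>
    have "expectation (\<lambda>\<omega>. (of_bool (Z t \<omega> = i) - \<rho> i)\<^sup>2) =
        expectation (\<lambda>\<omega>. (1 - 2 * \<rho> i) * of_bool (Z t \<omega> = i) + (\<rho> i)\<^sup>2)"
      by (intro Bochner_Integration.integral_cong) (auto simp: of_bool_def power2_eq_square algebra_simps)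
    also have "\<dots> = \<rho> i - (\<rho> i)\<^sup>2"
      using int E by (simp add: prob_space power2_eq_square algebra_simps)
    finally show "expectation (\<lambda>\<omega>. (of_bool (Z t \<omega> = i) - \<rho> i)\<^sup>2) \<le> \<rho> i"
      by simp
  qed simp
  then show ?thesis by simp
qed

text \<open>Keeping the label indicator as a factor avoids conditioning on the random class: the
  summands are independent over all \<open>t\<close> and centred, and their squares are at most the
  indicator, whose mean is \<open>\<rho> i\<close>.\<close>

lemma prob_class_edges:
  fixes l s :: real
  assumes i: "i \<in> {0..nL}" "0 < \<rho> i" and j: "j \<in> {1..n}" and l: "0 < l" "l \<le> 1"
  shows "prob {\<omega>\<in>space M. s \<le> \<bar>\<Sum>t=1..T. of_bool (Z t \<omega> = i) * (of_bool (G t j \<omega>) - A i j)\<bar>}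
    \<le> 2 * exp (l\<^sup>2 * T * \<rho> i - l * s)"
proof -
  have A: "0 \<le> A i j" "A i j \<le> 1" using A_range[OF i(1) j] by auto
  let ?X = "\<lambda>t \<omega>. of_bool (Z t \<omega> = i) * (of_bool (G t j \<omega>) - A i j)"
  have "prob {\<omega>\<in>space M. s \<le> \<bar>\<Sum>t\<in>{1..T}. ?X t \<omega>\<bar>} \<le> 2 * exp (l\<^sup>2 * card {1..T} * \<rho> i - l * s)"
  proof (intro prob_abs_sum_ge l)
    show "indep_vars (\<lambda>_. borel) ?X {1..T}"
      using indep_vars_compose2[OF indep_obs, of "\<lambda>_ w. of_bool (fst w = i) * (of_bool (snd w j) - A i j)" "\<lambda>_. borel"] j
      by (simp add: obs_def)
  next
    fix t assume t: "t \<in> {1..T}"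
    note [measurable] = pred_Z[OF t] pred_G[OF t j]
    show bound: "\<bar>?X t \<omega>\<bar> \<le> 1" for \<omega>
      using A by (auto simp: of_bool_def)
    have edge: "expectation (\<lambda>\<omega>. of_bool (G t j \<omega> \<and> Z t \<omega> = i)) = \<rho> i * A i j"
      using prob_label_marginal[OF t i j, of True] by (simp add: expectation_of_bool bern_def)
    have int: "integrable M (\<lambda>\<omega>. of_bool (G t j \<omega> \<and> Z t \<omega> = i) :: real)"
      by (intro integrable_const_bound[where B = 1]) (auto simp: of_bool_def)
    have "expectation (?X t) = expectation (\<lambda>\<omega>. of_bool (G t j \<omega> \<and> Z t \<omega> = i) - A i j * of_bool (Z t \<omega> = i))"
      by (intro Bochner_Integration.integral_cong) (auto simp: of_bool_def)
    also have "\<dots> = 0"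
      using int edge integrable_label[OF t, of i] expectation_label[OF t i(1)] by simp
    finally show "expectation (?X t) = 0" .
    have "expectation (\<lambda>\<omega>. (?X t \<omega>)\<^sup>2) \<le> expectation (\<lambda>\<omega>. of_bool (Z t \<omega> = i))"
    proof (intro integral_mono integrable_label t)
      show "integrable M (\<lambda>\<omega>. (?X t \<omega>)\<^sup>2)"
        using bound by (intro integrable_const_bound[where B = 1]) (auto simp: abs_square_le_1)
      show "(?X t \<omega>)\<^sup>2 \<le> of_bool (Z t \<omega> = i)" for \<omega>
        using bound[of \<omega>] by (auto simp: of_bool_def abs_square_le_1 split: if_splits)
    qed
    then show "expectation (\<lambda>\<omega>. (?X t \<omega>)\<^sup>2) \<le> \<rho> i"
      using expectation_label[OF t i(1)] by simp
  qed simp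
  then show ?thesis by simp
qed

lemma class_concentration:
  fixes l s R :: real
  assumes rho: "\<And>i. i \<in> {0..nL} \<Longrightarrow> 0 < \<rho> i \<and> \<rho> i \<le> R" and l: "0 < l" "l \<le> 1"
  shows "\<exists>E\<in>sets M. prob E \<le> 2 * real (nL + 1) * real (n + 1) * exp (l\<^sup>2 * T * R - l * s) \<and>
    (\<forall>\<omega>\<in>space M - E. \<forall>i\<in>{0..nL}. \<bar>\<Sum>t=1..T. of_bool (Z t \<omega> = i) - \<rho> i\<bar> < s \<and>
      (\<forall>j\<in>{1..n}. \<bar>\<Sum>t=1..T. of_bool (Z t \<omega> = i) * (of_bool (G t j \<omega>) - A i j)\<bar> < s))"
proof -
  \<comment> \<open>Nodes start at \<open>1\<close>, so the index \<open>j = 0\<close> is free to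
    carry the class size. A single union bound then covers both kinds of sums.\<close>
  define X where "X i j t \<omega> = (if j = 0 then of_bool (Z t \<omega> = i) - \<rho> i
    else of_bool (Z t \<omega> = i) * (of_bool (G t j \<omega>) - A i j))" for i j t \<omega>
  define E where "E = (\<lambda>(i, j). {\<omega>\<in>space M. s \<le> \<bar>\<Sum>t=1..T. X i j t \<omega>\<bar>})"
  let ?I = "{0..nL} \<times> {0..n}"
  have sets: "E (i, j) \<in> sets M" if "j \<in> {0..n}" for i j
  proof -
    have [measurable]: "X i j t \<in> borel_measurable M" if t: "t \<in> {1..T}" for t
    proof (cases "j = 0")
      case True
      note [measurable] = pred_Z[OF t]
      show ?thesis unfolding X_def of_bool_def using True by simp
    next
      case False
      then have j: "j \<in> {1..n}" using \<open>j \<in> {0..n}\<close> by simp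
      note [measurable] = pred_Z[OF t] pred_G[OF t j]
      show ?thesis unfolding X_def of_bool_def using False by simp
    qed
    show ?thesis unfolding E_def prod.case by measurable
  qed
  have each: "prob (E (i, j)) \<le> 2 * exp (l\<^sup>2 * T * R - l * s)" if i: "i \<in> {0..nL}" and j: "j \<in> {0..n}" for i j
  proof -
    have "prob (E (i, j)) \<le> 2 * exp (l\<^sup>2 * T * \<rho> i - l * s)"
    proof (cases "j = 0")
      case True
      then show ?thesis using prob_class_size[OF i l] by (simp add: E_def X_def)
    next
      case False
      then show ?thesis using prob_class_edges[OF i _ _ l] rho[OF i] j by (simp add: E_def X_def)
    qed
    also have "\<dots> \<le> 2 * exp (l\<^sup>2 * T * R - l * s)"
      using rho[OF i] by (simp add: mult_left_mono)
    finally show ?thesis .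
  qed
  have "prob (\<Union>p\<in>?I. E p) \<le> (\<Sum>p\<in>?I. prob (E p))"
    using sets by (intro finite_measure_subadditive_finite) auto
  also have "\<dots> \<le> (\<Sum>p\<in>?I. 2 * exp (l\<^sup>2 * T * R - l * s))"
    using each by (intro sum_mono) blast
  also have "\<dots> = 2 * real (nL + 1) * real (n + 1) * exp (l\<^sup>2 * T * R - l * s)"
    by (simp add: card_cartesian_product algebra_simps)
  finally have "prob (\<Union>p\<in>?I. E p) \<le> 2 * real (nL + 1) * real (n + 1) * exp (l\<^sup>2 * T * R - l * s)" .
  moreover have "\<bar>\<Sum>t=1..T. X i j t \<omega>\<bar> < s" if "\<omega> \<in> space M - (\<Union>p\<in>?I. E p)" "i \<in> {0..nL}" "j \<in> {0..n}" for \<omega> i j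
    using that by (force simp: E_def not_le)
  then have "\<forall>\<omega>\<in>space M - (\<Union>p\<in>?I. E p). \<forall>i\<in>{0..nL}. \<bar>\<Sum>t=1..T. of_bool (Z t \<omega> = i) - \<rho> i\<bar> < s \<and>
      (\<forall>j\<in>{1..n}. \<bar>\<Sum>t=1..T. of_bool (Z t \<omega> = i) * (of_bool (G t j \<omega>) - A i j)\<bar> < s)"
  proof (intro ballI conjI, goal_cases)
    case (1 \<omega> i)
    from 1(1)[OF 1(2,3), of 0] show ?case by (simp add: X_def)
  next
    case (2 \<omega> i j)
    from 2(1)[OF 2(2,3), of j] 2(4) show ?case by (simp add: X_def)
  qed
  moreover have "(\<Union>p\<in>?I. E p) \<in> sets M"
    using sets by (intro sets.finite_UN) auto
  ultimately show ?thesis by blast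
qed

end

section \<open>From squared error to the estimate\<close>

lemma sum_of_bool_card: "finite S \<Longrightarrow> (\<Sum>t\<in>S. of_bool (P t)) = real (card {t\<in>S. P t})"
  by (simp add: Int_def sum_of_bool_eq)

text \<open>Members of both classes in group \<open>a\<close> are fitted by the same row
  \<open>B a\<close>, which cannot be close to two rows that differ by \<open>d\<close> on
  \<open>V\<close>. By the parallelogram identity the two squared distances add up to at least
  \<open>d^2 / 2\<close> at each node of \<open>V\<close>, and at least \<open>k\<close>
  observations pay each of them.\<close>

lemma confusion_le_squared_error:
  fixes A B :: "nat \<Rightarrow> nat \<Rightarrow> real" and d :: real and k n T :: nat
  assumes ne: "b \<noteq> b'" and V: "V \<subseteq> {1..n}" and d: "0 \<le> d"
    and sep: "\<And>j. j \<in> V \<Longrightarrow> d \<le> \<bar>A b j - A b' j\<bar>"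
    and k: "k \<le> card {t\<in>{1..T}. z t = a \<and> y t = b}" "k \<le> card {t\<in>{1..T}. z t = a \<and> y t = b'}"
  shows "real k * (real (card V) * d\<^sup>2 / 2) \<le> (\<Sum>t=1..T. \<Sum>j=1..n. (B (z t) j - A (y t) j)\<^sup>2)"
proof -
  let ?S = "\<lambda>c. {t\<in>{1..T}. z t = a \<and> y t = c}"
  let ?e = "\<lambda>c. \<Sum>j\<in>V. (B a j - A c j)\<^sup>2"
  have fin: "finite (?S c)" for c
    by (rule finite_subset[of _ "{1..T}"]) auto
  have "real (card V) * d\<^sup>2 / 2 = (\<Sum>j\<in>V. d\<^sup>2 / 2)"
    by simp
  also have "\<dots> \<le> (\<Sum>j\<in>V. (B a j - A b j)\<^sup>2 + (B a j - A b' j)\<^sup>2)"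
  proof (intro sum_mono)
    fix j assume j: "j \<in> V"
    have "d\<^sup>2 \<le> (A b j - A b' j)\<^sup>2"
      using power_mono[OF sep[OF j] d, of 2] by simp
    also have "\<dots> \<le> 2 * ((B a j - A b j)\<^sup>2 + (B a j - A b' j)\<^sup>2)"
    proof -
      have "2 * ((x - p)\<^sup>2 + (x - q)\<^sup>2) = (p - q)\<^sup>2 + (2 * x - p - q)\<^sup>2" for x p q :: real
        by (simp add: power2_eq_square algebra_simps)
      then show ?thesis by simp
    qed
    finally show "d\<^sup>2 / 2 \<le> (B a j - A b j)\<^sup>2 + (B a j - A b' j)\<^sup>2" by simp
  qed
  also have "\<dots> = ?e b + ?e b'"
    by (rule sum.distrib)
  finally have "real k * (real (card V) * d\<^sup>2 / 2) \<le> real k * (?e b + ?e b')"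
    by (intro mult_left_mono) auto
  also have "\<dots> \<le> real (card (?S b)) * ?e b + real (card (?S b')) * ?e b'"
    using k by (simp add: distrib_left add_mono mult_right_mono sum_nonneg)
  also have "\<dots> = (\<Sum>t\<in>?S b. \<Sum>j\<in>V. (B (z t) j - A (y t) j)\<^sup>2) + (\<Sum>t\<in>?S b'. \<Sum>j\<in>V. (B (z t) j - A (y t) j)\<^sup>2)"
    by simp
  also have "\<dots> = (\<Sum>t\<in>?S b \<union> ?S b'. \<Sum>j\<in>V. (B (z t) j - A (y t) j)\<^sup>2)"
    using ne by (intro sum.union_disjoint[symmetric] fin) auto
  also have "\<dots> \<le> (\<Sum>t=1..T. \<Sum>j\<in>V. (B (z t) j - A (y t) j)\<^sup>2)"
    by (intro sum_mono2 sum_nonneg) auto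
  also have "\<dots> \<le> (\<Sum>t=1..T. \<Sum>j=1..n. (B (z t) j - A (y t) j)\<^sup>2)"
    using V by (intro sum_mono sum_mono2) auto
  finally show ?thesis .
qed

text \<open>
  Each class \<open>b\<close> dominates some estimated group \<open>\<sigma> b\<close>, and no group is dominated twice, so
  \<open>\<sigma>\<close> is a permutation. The bound on the positive labels leaves only the identity.
\<close>

lemma dominant_groups_identity:
  fixes N :: "nat \<Rightarrow> nat \<Rightarrow> real" and \<eta> m :: real
  assumes unique: "\<And>a b b'. a \<in> {0..nL} \<Longrightarrow> b \<in> {0..nL} \<Longrightarrow> b' \<in> {0..nL} \<Longrightarrow> b \<noteq> b' \<Longrightarrow>
      N a b \<le> \<eta> \<or> N a b' \<le> \<eta>"
    and size: "\<And>b. b \<in> {0..nL} \<Longrightarrow> m \<le> (\<Sum>a=0..nL. N a b)"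
    and eta: "real (nL + 1) * \<eta> < m"
    and leader: "\<And>a b. a \<in> {1..nL} \<Longrightarrow> b \<in> {0..nL} \<Longrightarrow> a \<noteq> b \<Longrightarrow> N a b + real nL * \<eta> < m"
    and ab: "a \<in> {0..nL}" "b \<in> {0..nL}" "a \<noteq> b"
  shows "N a b \<le> \<eta>"
proof -
  \<comment> \<open>A class of size at least \<open>m\<close> does not fit into
    \<open>nL + 1\<close> cells of size at most \<open>\<eta>\<close>.\<close>
  have "\<exists>a\<in>{0..nL}. \<eta> < N a b" if "b \<in> {0..nL}" for b
  proof (rule ccontr)
    assume "\<not> ?thesis"
    then have "(\<Sum>a=0..nL. N a b) \<le> (\<Sum>a=0..nL. \<eta>)" by (intro sum_mono) (simp add: not_less)
    with size[OF that] eta show False by simp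
  qed
  then obtain \<sigma> where \<sigma>: "\<And>b. b \<in> {0..nL} \<Longrightarrow> \<sigma> b \<in> {0..nL} \<and> \<eta> < N (\<sigma> b) b"
    by metis
  have inj: "inj_on \<sigma> {0..nL}"
  proof (rule inj_onI, rule ccontr)
    fix b b' assume b: "b \<in> {0..nL}" "b' \<in> {0..nL}" "\<sigma> b = \<sigma> b'" "b \<noteq> b'"
    have "\<eta> < N (\<sigma> b) b" "\<eta> < N (\<sigma> b) b'" "\<sigma> b \<in> {0..nL}"
      using \<sigma>[OF b(1)] \<sigma>[OF b(2)] b(3) by simp_all
    with unique[of "\<sigma> b", OF _ b(1,2,4)] show False by linarith
  qed
  then have surj: "\<sigma> ` {0..nL} = {0..nL}"
    using \<sigma> by (intro endo_inj_surj image_subsetI) simp_all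
  have others: "N a b \<le> \<eta>" if "a \<in> {0..nL}" "b \<in> {0..nL}" "a \<noteq> \<sigma> b" for a b
  proof -
    from that(1) have "a \<in> \<sigma> ` {0..nL}" unfolding surj .
    then obtain b' where b': "a = \<sigma> b'" "b' \<in> {0..nL}" by (rule imageE)
    then have "b \<noteq> b'" "\<not> N a b' \<le> \<eta>" using \<sigma>[of b'] that(3) by auto
    then show ?thesis using unique[OF that(1,2) b'(2)] by blast
  qed
  \<comment> \<open>The other \<open>nL\<close> groups hold at most \<open>\<eta>\<close> members of
    class \<open>b\<close> each. So group \<open>\<sigma> b\<close> holds nearly the whole class,
    more than \<open>leader\<close> allows a positive label other than \<open>b\<close>.\<close>
  have dominant: "m \<le> N (\<sigma> b) b + real nL * \<eta>" if b: "b \<in> {0..nL}" for b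
  proof -
    have "(\<Sum>a=0..nL. N a b) = N (\<sigma> b) b + (\<Sum>a\<in>{0..nL} - {\<sigma> b}. N a b)"
      using \<sigma>[OF b] by (intro sum.remove) auto
    moreover have "(\<Sum>a\<in>{0..nL} - {\<sigma> b}. N a b) \<le> (\<Sum>a\<in>{0..nL} - {\<sigma> b}. \<eta>)"
      using others b by (intro sum_mono) auto
    moreover have "(\<Sum>a\<in>{0..nL} - {\<sigma> b}. \<eta>) = real nL * \<eta>"
      using \<sigma>[OF b] by simp
    ultimately show ?thesis using size[OF b] by linarith
  qed
  have positive: "\<sigma> b = b" if "b \<in> {0..nL}" "\<sigma> b \<noteq> 0" for b
  proof (rule ccontr)
    assume ne: "\<sigma> b \<noteq> b"
    have "\<sigma> b \<in> {1..nL}" using \<sigma>[OF that(1)] that(2) by auto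
    from leader[OF this that(1) ne] dominant[OF that(1)] show False by linarith
  qed
  \<comment> \<open>A positive value of \<open>\<sigma> 0\<close> would have to be \<open>0\<close>
    by \<open>positive\<close>. By injectivity no other class then goes to \<open>0\<close>, so
    \<open>positive\<close> covers all of them.\<close>
  have zero: "\<sigma> 0 = 0" using positive[of 0] by auto
  have "\<sigma> b = b"
  proof (cases "b = 0")
    case False
    then have "\<sigma> b \<noteq> 0" using inj zero ab(2) by (metis atLeastAtMost_iff inj_on_eq_iff zero_le)
    then show ?thesis using positive ab(2) by blast
  qed (simp add: zero)
  then show ?thesis using others ab by simp
qed

text \<open>Times the group size, the deviation is the centred edge sum over group \<open>i\<close>.
  Passing to the sum over class \<open>i\<close> changes at most \<open>2 * \<mu>\<close> terms,
  each of absolute value at most \<open>1\<close>.\<close>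

lemma A_hat_deviation:
  fixes g :: "nat \<Rightarrow> nat \<Rightarrow> bool" and p s \<mu> :: real
  assumes p: "p \<in> {0..1}"
    and dev: "\<bar>\<Sum>t=1..T. of_bool (y t = i) * (of_bool (g t j) - p)\<bar> \<le> s"
    and extra: "real (card {t\<in>{1..T}. z t = i \<and> y t \<noteq> i}) \<le> \<mu>"
    and missing: "real (card {t\<in>{1..T}. y t = i \<and> z t \<noteq> i}) \<le> \<mu>"
    and size: "m \<le> real (card {t\<in>{1..T}. z t = i})" "0 < m"
  shows "\<bar>A_hat T g z i j - p\<bar> \<le> (s + 2 * \<mu>) / m"
proof -
  define c where "c = real (card {t\<in>{1..T}. z t = i})"
  have c: "0 < c" using size by (simp add: c_def)
  have sum_c: "(\<Sum>t=1..T. of_bool (z t = i)) = c"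
    unfolding c_def by (intro sum_of_bool_card) simp
  have "(A_hat T g z i j - p) * c = (\<Sum>t=1..T. of_bool (g t j) * of_bool (z t = i)) - p * c"
    using c unfolding A_hat_def group_size_def c_def[symmetric] by (simp add: left_diff_distrib)
  also have "\<dots> = (\<Sum>t=1..T. of_bool (z t = i) * (of_bool (g t j) - p))"
    unfolding sum_c[symmetric] by (simp add: algebra_simps sum_subtractf sum_distrib_left)
  also have "\<dots> = (\<Sum>t=1..T. of_bool (y t = i) * (of_bool (g t j) - p))
      + (\<Sum>t=1..T. (of_bool (z t = i) - of_bool (y t = i)) * (of_bool (g t j) - p))"
    by (simp add: sum.distrib[symmetric] algebra_simps)
  finally have "\<bar>(A_hat T g z i j - p) * c\<bar> \<le> s
      + \<bar>\<Sum>t=1..T. (of_bool (z t = i) - of_bool (y t = i)) * (of_bool (g t j) - p)\<bar>"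
    using dev by linarith
  also have "\<bar>\<Sum>t=1..T. (of_bool (z t = i) - of_bool (y t = i)) * (of_bool (g t j) - p)\<bar>
      \<le> (\<Sum>t=1..T. \<bar>(of_bool (z t = i) - of_bool (y t = i)) * (of_bool (g t j) - p)\<bar>)"
    by (rule sum_abs)
  also have "\<dots> \<le> (\<Sum>t=1..T. of_bool (z t = i \<and> y t \<noteq> i) + of_bool (y t = i \<and> z t \<noteq> i))"
    using p by (intro sum_mono) (auto simp: of_bool_def)
  also have "\<dots> = real (card {t\<in>{1..T}. z t = i \<and> y t \<noteq> i}) + real (card {t\<in>{1..T}. y t = i \<and> z t \<noteq> i})"
    by (simp only: sum.distrib sum_of_bool_card[OF finite_atLeastAtMost])
  finally have "\<bar>A_hat T g z i j - p\<bar> * c \<le> s + 2 * \<mu>"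
    using extra missing c by (simp add: abs_mult)
  moreover have "\<bar>A_hat T g z i j - p\<bar> * m \<le> \<bar>A_hat T g z i j - p\<bar> * c"
    using size by (intro mult_left_mono) (auto simp: c_def)
  ultimately show ?thesis using size by (simp add: pos_le_divide_eq)
qed

section \<open>Deterministic deviation bound for the maximiser\<close>

lemma card_eq_sum_labels:
  assumes "finite I" "\<And>t. t \<in> S \<Longrightarrow> z t \<in> I" "finite S"
  shows "card S = (\<Sum>a\<in>I. card {t\<in>S. z t = a})"
proof -
  have "card S = card (\<Union>a\<in>I. {t\<in>S. z t = a})"
    using assms by (intro arg_cong[where f = card]) auto
  also have "\<dots> = (\<Sum>a\<in>I. card {t\<in>S. z t = a})"
    using assms by (intro card_UN_disjoint) auto
  finally show ?thesis .
qed

text \<open>In each group all classes but one have at most \<open>\<eta>\<close> members, as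
  otherwise the squared error would exceed \<open>D\<close>. Feasibility and sparse leader columns
  then identify groups with classes. Summing the small cells, group \<open>i\<close> and class
  \<open>i\<close> differ by at most \<open>real nL * \<eta>\<close> observations on either
  side.\<close>

lemma (in hub_model) A_hat_mle_deviation:
  fixes s m mx \<eta> \<kappa> d D w :: real
  assumes reg: "regular \<omega>"
    and mle: "profile_mle nL n T (\<lambda>t j. G t j \<omega>) z"
    and err: "(\<Sum>t=1..T. \<Sum>j=1..n. (A_hat T (\<lambda>t j. G t j \<omega>) z (z t) j - A (Z t \<omega>) j)\<^sup>2) \<le> D"
    and class_dev: "\<And>i. i \<in> {0..nL} \<Longrightarrow> \<bar>\<Sum>t=1..T. of_bool (Z t \<omega> = i) - \<rho> i\<bar> \<le> s"
    and edges: "\<And>i j. i \<in> {0..nL} \<Longrightarrow> j \<in> {1..n} \<Longrightarrow>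
      \<bar>\<Sum>t=1..T. of_bool (Z t \<omega> = i) * (of_bool (G t j \<omega>) - A i j)\<bar> \<le> s"
    and sep: "\<And>i. i \<in> {1..nL} \<Longrightarrow> \<exists>V\<subseteq>{1..n}. w \<le> real (card V) \<and>
      (\<forall>j\<in>V. \<forall>i'\<in>{0..nL}. i' \<noteq> i \<longrightarrow> A i j - A i' j \<ge> d)"
    and d: "0 < d" and w: "0 < w"
    and sparse: "\<And>i i'. i \<in> {0..nL} \<Longrightarrow> i' \<in> {1..nL} \<Longrightarrow> i \<noteq> i' \<Longrightarrow> A i i' \<le> \<kappa>"
    and kappa: "0 \<le> \<kappa>"
    and rho: "\<And>i. i \<in> {0..nL} \<Longrightarrow> m \<le> T * \<rho> i - s \<and> T * \<rho> i + s \<le> mx"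
    and eta: "2 * D / (w * d\<^sup>2) \<le> \<eta>" "real (nL + 1) * \<eta> < m"
    and leader: "\<kappa> * mx + s + real nL * \<eta> < m"
    and i: "i \<in> {0..nL}" and j: "j \<in> {1..n}"
  shows "\<bar>A_hat T (\<lambda>t j. G t j \<omega>) z i j - A i j\<bar> \<le> (s + 2 * (real nL * \<eta>)) / (m - real nL * \<eta>)"
proof -
  define N where "N a b = card {t\<in>{1..T}. z t = a \<and> Z t \<omega> = b}" for a b
  have z: "z t \<in> {0..nL}" "z t = 0 \<or> G t (z t) \<omega>" if "t \<in> {1..T}" for t
    using mle that by (auto simp: profile_mle_def is_arg_max_def feasible_def)
  have Z: "Z t \<omega> \<in> {0..nL}" if "t \<in> {1..T}" for t
    using reg that by (simp add: regular_def)
  have class_card: "real (card {t\<in>{1..T}. Z t \<omega> = b}) = (\<Sum>t=1..T. of_bool (Z t \<omega> = b))" for b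
    by (intro sum_of_bool_card[symmetric]) simp
  have class_size: "m \<le> real (card {t\<in>{1..T}. Z t \<omega> = b})" "real (card {t\<in>{1..T}. Z t \<omega> = b}) \<le> mx"
    if b: "b \<in> {0..nL}" for b
    using class_dev[OF b] rho[OF b]
    unfolding sum_subtractf class_card[symmetric] sum_constant card_atLeastAtMost diff_Suc_1
    by linarith+
  have class_sum: "card {t\<in>{1..T}. Z t \<omega> = b} = (\<Sum>a=0..nL. N a b)" for b
    using card_eq_sum_labels[of "{0..nL}" "{t\<in>{1..T}. Z t \<omega> = b}" z] z(1)
    by (simp add: N_def conj_commute conj_left_commute)
  have unique: "real (N a b) \<le> \<eta> \<or> real (N a b') \<le> \<eta>"
    if labels: "b \<in> {0..nL}" "b' \<in> {0..nL}" and ne: "b \<noteq> b'" for a b b'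
  proof -
    define k where "k = min (N a b) (N a b')"
    \<comment> \<open>Separating sets are available for positive labels only. A pair containing
      \<open>0\<close> is separated by the set of its other member.\<close>
    have swap: "\<exists>V\<subseteq>{1..n}. w \<le> real (card V) \<and> (\<forall>j\<in>V. d \<le> \<bar>A c j - A c' j\<bar>)"
      if c: "c \<in> {0..nL}" "c' \<in> {0..nL}" "c \<noteq> c'" "c \<noteq> 0" for c c'
    proof -
      have "c \<in> {1..nL}" using c by auto
      from sep[OF this] obtain V where V: "V \<subseteq> {1..n}" "w \<le> real (card V)"
        "\<forall>j\<in>V. \<forall>i'\<in>{0..nL}. i' \<noteq> c \<longrightarrow> A c j - A i' j \<ge> d" by blast
      have "d \<le> \<bar>A c j - A c' j\<bar>" if "j \<in> V" for j
        using V(3)[rule_format, OF that c(2)] c(3) by linarith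
      with V(1,2) show ?thesis by blast
    qed
    have "\<exists>V\<subseteq>{1..n}. w \<le> real (card V) \<and> (\<forall>j\<in>V. d \<le> \<bar>A b j - A b' j\<bar>)"
    proof (cases "b = 0")
      case True
      then show ?thesis
        using swap[of b' b] labels ne by (simp add: abs_minus_commute)
    qed (use swap[of b b'] labels ne in blast)
    then obtain V where V: "V \<subseteq> {1..n}" "w \<le> real (card V)" "\<forall>j\<in>V. d \<le> \<bar>A b j - A b' j\<bar>"
      by blast
    have "real k * (w * d\<^sup>2 / 2) \<le> real k * (real (card V) * d\<^sup>2 / 2)"
      using V(2) by (intro mult_left_mono divide_right_mono mult_right_mono) auto
    also have "\<dots> \<le> (\<Sum>t=1..T. \<Sum>j=1..n. (A_hat T (\<lambda>t j. G t j \<omega>) z (z t) j - A (Z t \<omega>) j)\<^sup>2)"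
      using V(3) d by (intro confusion_le_squared_error[OF ne V(1), where a = a]) (simp_all add: k_def N_def)
    finally have "real k * (w * d\<^sup>2 / 2) \<le> D" using err by linarith
    then have "real k \<le> 2 * D / (w * d\<^sup>2)"
      using d w by (simp add: field_simps)
    then show ?thesis using eta(1) by (auto simp: k_def min_def split: if_splits)
  qed
  \<comment> \<open>By feasibility every observation in group \<open>a > 0\<close> has an edge to
    \<open>a\<close>. In class \<open>b \<noteq> a\<close> such edges have probability at most
    \<open>\<kappa>\<close>, so edge concentration bounds their number.\<close>
  have N_leader: "real (N a b) \<le> \<kappa> * mx + s" if a: "a \<in> {1..nL}" and b: "b \<in> {0..nL}" and ne: "a \<noteq> b" for a b
  proof -
    have an: "a \<in> {1..n}" using a nL_le_n by auto
    have "real (N a b) = (\<Sum>t=1..T. of_bool (z t = a \<and> Z t \<omega> = b))"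
      unfolding N_def by (intro sum_of_bool_card[symmetric]) simp
    moreover have "(\<Sum>t=1..T. of_bool (z t = a \<and> Z t \<omega> = b)) \<le>
        (\<Sum>t=1..T. of_bool (Z t \<omega> = b) * (of_bool (G t a \<omega>) - A b a) + A b a * of_bool (Z t \<omega> = b))"
    proof (intro sum_mono)
      fix t assume "t \<in> {1..T}"
      from z(2)[OF this] a have "z t = a \<Longrightarrow> G t a \<omega>" by auto
      then show "of_bool (z t = a \<and> Z t \<omega> = b) \<le>
          of_bool (Z t \<omega> = b) * (of_bool (G t a \<omega>) - A b a) + A b a * of_bool (Z t \<omega> = b)"
        by (auto simp: of_bool_def)
    qed
    moreover have "(\<Sum>t=1..T. of_bool (Z t \<omega> = b) * (of_bool (G t a \<omega>) - A b a) + A b a * of_bool (Z t \<omega> = b)) =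
        (\<Sum>t=1..T. of_bool (Z t \<omega> = b) * (of_bool (G t a \<omega>) - A b a))
        + A b a * real (card {t\<in>{1..T}. Z t \<omega> = b})"
      unfolding class_card sum.distrib sum_distrib_left ..
    moreover have "A b a * real (card {t\<in>{1..T}. Z t \<omega> = b}) \<le> \<kappa> * mx"
      using sparse[OF b a] ne class_size(2)[OF b] kappa by (intro mult_mono) simp_all
    ultimately show ?thesis using edges[OF b an] by linarith
  qed
  have off: "real (N a b) \<le> \<eta>" if "a \<in> {0..nL}" "b \<in> {0..nL}" "a \<noteq> b" for a b
  proof (rule dominant_groups_identity[where N = "\<lambda>a b. real (N a b)" and m = m])
    show "m \<le> (\<Sum>a=0..nL. real (N a b))" if "b \<in> {0..nL}" for b
      using class_size(1)[OF that] class_sum[of b] by simp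
    show "real (N a b) + real nL * \<eta> < m" if "a \<in> {1..nL}" "b \<in> {0..nL}" "a \<noteq> b" for a b
      using N_leader[OF that] leader by linarith
  qed (use unique eta that in auto)
  have extra: "real (card {t\<in>{1..T}. z t = i \<and> Z t \<omega> \<noteq> i}) \<le> real nL * \<eta>"
  proof -
    have "card {t\<in>{1..T}. z t = i \<and> Z t \<omega> \<noteq> i} =
        (\<Sum>b\<in>{0..nL} - {i}. card {t\<in>{t\<in>{1..T}. z t = i \<and> Z t \<omega> \<noteq> i}. Z t \<omega> = b})"
      using Z by (intro card_eq_sum_labels) auto
    also have "\<dots> = (\<Sum>b\<in>{0..nL} - {i}. N i b)"
      unfolding N_def by (intro sum.cong refl arg_cong[where f = card]) auto
    finally have "real (card {t\<in>{1..T}. z t = i \<and> Z t \<omega> \<noteq> i}) = (\<Sum>b\<in>{0..nL} - {i}. real (N i b))"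
      by simp
    also have "\<dots> \<le> (\<Sum>b\<in>{0..nL} - {i}. \<eta>)"
      using off i by (intro sum_mono) auto
    finally show ?thesis using i by simp
  qed
  have missing: "real (card {t\<in>{1..T}. Z t \<omega> = i \<and> z t \<noteq> i}) \<le> real nL * \<eta>"
  proof -
    have "card {t\<in>{1..T}. Z t \<omega> = i \<and> z t \<noteq> i} =
        (\<Sum>a\<in>{0..nL} - {i}. card {t\<in>{t\<in>{1..T}. Z t \<omega> = i \<and> z t \<noteq> i}. z t = a})"
      using z by (intro card_eq_sum_labels) auto
    also have "\<dots> = (\<Sum>a\<in>{0..nL} - {i}. N a i)"
      unfolding N_def by (intro sum.cong refl arg_cong[where f = card]) auto
    finally have "real (card {t\<in>{1..T}. Z t \<omega> = i \<and> z t \<noteq> i}) = (\<Sum>a\<in>{0..nL} - {i}. real (N a i))"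
      by simp
    also have "\<dots> \<le> (\<Sum>a\<in>{0..nL} - {i}. \<eta>)"
      using off i by (intro sum_mono) auto
    finally show ?thesis using i by simp
  qed
  \<comment> \<open>Group \<open>i\<close> contains all of class \<open>i\<close> except the missing
    observations, which bounds its size from below.\<close>
  have "m \<le> real (card {t\<in>{1..T}. Z t \<omega> = i})" by (rule class_size(1)[OF i])
  also have "card {t\<in>{1..T}. Z t \<omega> = i} \<le>
      card ({t\<in>{1..T}. z t = i} \<union> {t\<in>{1..T}. Z t \<omega> = i \<and> z t \<noteq> i})"
    by (intro card_mono) auto
  also have "\<dots> \<le> card {t\<in>{1..T}. z t = i} + card {t\<in>{1..T}. Z t \<omega> = i \<and> z t \<noteq> i}"
    by (rule card_Un_le)
  finally have group: "m - real nL * \<eta> \<le> real (card {t\<in>{1..T}. z t = i})"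
    using missing by simp
  have "0 \<le> s" using class_dev[OF i] by linarith
  moreover have "0 \<le> mx" using class_size(2)[OF i] by (meson of_nat_0_le_iff order_trans)
  ultimately have "0 < m - real nL * \<eta>"
    using leader mult_nonneg_nonneg[OF kappa, of mx] by linarith
  then show ?thesis
    by (intro A_hat_deviation[where y = "\<lambda>t. Z t \<omega>"] A_range edges extra missing group i j)
qed

section \<open>Asymptotics\<close>

text \<open>The logarithm of the count has two terms, and each takes half of the right-hand side:
  \<open>T * ln (nL + 1)\<close>, from the labellings, is controlled by \<open>r3\<close>, and
  \<open>(nL + 1) * n * ln (T + 1)\<close>, from the count tables, by \<open>r2\<close>. Spare
  powers of \<open>nL\<close>, \<open>d\<close> and \<open>v\<close> are given away.\<close>

lemma log_count_le:
  fixes \<epsilon> d v :: real and nL n T :: nat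
  assumes nL: "2 \<le> nL" and T: "2 \<le> T" and n: "1 \<le> n"
    and d: "0 < d" "d \<le> 1" and v: "0 < v" "v \<le> 1" and eps: "0 < \<epsilon>"
    and r2: "(real nL ^ 5 * ln (real T)) / (d\<^sup>2 * v * real T) \<le> \<epsilon> / 128"
    and r3: "(real nL ^ 8 * ln (real nL)) / (d ^ 4 * v\<^sup>2 * real n) \<le> \<epsilon> / 64"
  shows "16 * real nL ^ 3 * ln (real ((nL + 1) ^ T * (T + 1) ^ ((nL + 1) * n))) \<le> \<epsilon> * d\<^sup>2 * v * n * T"
proof -
  have log: "ln (real (x + 1)) \<le> 2 * ln (real x)" if "2 \<le> x" for x :: nat
  proof -
    have "x + 1 \<le> x * 2" using that by simp
    also have "\<dots> \<le> x * x" using that by (intro mult_left_mono) auto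
    finally have "ln (real (x + 1)) \<le> ln (real (x * x))"
      by (subst ln_le_cancel_iff) (use that in \<open>auto simp flip: of_nat_mult\<close>)
    then show ?thesis using that by (simp add: ln_mult)
  qed
  have lnn: "0 \<le> ln (real nL)" "0 \<le> ln (real T)" using nL T by simp_all
  have count: "ln (real ((nL + 1) ^ T * (T + 1) ^ ((nL + 1) * n))) =
      real T * ln (real (nL + 1)) + real (nL + 1) * real n * ln (real (T + 1))"
    by (simp only: of_nat_mult of_nat_power) (simp add: ln_mult ln_realpow algebra_simps)
  have "16 * real nL ^ 3 * (real T * ln (real (nL + 1))) \<le> 16 * real nL ^ 8 * (real T * (2 * ln (real nL)))"
    using nL lnn by (intro mult_mono log power_increasing) auto
  moreover have "16 * real nL ^ 8 * (real T * (2 * ln (real nL))) \<le> \<epsilon> / 2 * (d ^ 4 * v\<^sup>2) * n * T"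
  proof -
    have "real nL ^ 8 * ln (real nL) \<le> \<epsilon> / 64 * (d ^ 4 * v\<^sup>2 * real n)"
      using r3 d v n by (simp add: pos_divide_le_eq)
    then have "32 * T * (real nL ^ 8 * ln (real nL)) \<le> 32 * T * (\<epsilon> / 64 * (d ^ 4 * v\<^sup>2 * real n))"
      by (intro mult_left_mono) auto
    then show ?thesis by (simp add: mult_ac)
  qed
  moreover have "\<epsilon> / 2 * (d ^ 4 * v\<^sup>2) * n * T \<le> \<epsilon> / 2 * (d\<^sup>2 * v) * n * T"
    using d v eps power_decreasing[of 2 4 d] power_decreasing[of 1 2 v]
    by (intro mult_right_mono mult_left_mono mult_mono) auto
  moreover have "16 * real nL ^ 3 * (real (nL + 1) * real n * ln (real (T + 1))) \<le>
      16 * real nL ^ 3 * ((2 * real nL) * real n * (2 * ln (real T)))"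
    using nL T lnn by (intro mult_left_mono mult_mono log) auto
  moreover have "16 * real nL ^ 3 * ((2 * real nL) * real n * (2 * ln (real T))) \<le> \<epsilon> / 2 * (d\<^sup>2 * v) * n * T"
  proof -
    have "16 * real nL ^ 3 * ((2 * real nL) * real n * (2 * ln (real T))) = 64 * n * (real nL ^ 4 * ln (real T))"
      by (simp add: eval_nat_numeral)
    also have "\<dots> \<le> 64 * n * (real nL ^ 5 * ln (real T))"
      using nL lnn by (intro mult_left_mono mult_right_mono power_increasing) auto
    also have "\<dots> \<le> 64 * n * (\<epsilon> / 128 * (d\<^sup>2 * v * real T))"
      using r2 d v T by (intro mult_left_mono) (auto simp: pos_divide_le_eq)
    finally show ?thesis by (simp add: mult_ac)
  qed
  ultimately show ?thesis
    unfolding count distrib_left by (simp add: mult_ac)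
qed

text \<open>Everything is measured in units of \<open>x = T / nL\<close>, the order of a class size.
  Sampling error and misplaced observations contribute at most \<open>3 * \<epsilon> * x\<close>
  against a group size of at least \<open>3 / 4 * c_min * x\<close>, so the deviation is at most
  \<open>4 * \<epsilon> / c_min\<close>.\<close>

lemma (in hub_model) prob_max_deviation_le:
  fixes z :: "'a \<Rightarrow> nat \<Rightarrow> nat" and \<epsilon> l e d v c_min c_max c\<^sub>0 :: real
  assumes pos: "1 \<le> nL" "1 \<le> T" "1 \<le> n"
    and mle: "\<And>\<omega>. \<omega> \<in> space M \<Longrightarrow> profile_mle nL n T (\<lambda>t j. G t j \<omega>) (z \<omega>)"
    and c: "0 < c_min" "0 < c_max" "0 < c\<^sub>0"
    and rho: "\<And>i. i \<in> {0..nL} \<Longrightarrow> c_min / nL \<le> \<rho> i \<and> \<rho> i \<le> c_max / nL"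
    and sep: "\<And>i. i \<in> {1..nL} \<Longrightarrow> \<exists>V\<subseteq>{1..n}. real (card V) \<ge> v * real n / real nL \<and>
      (\<forall>j\<in>V. \<forall>i'\<in>{0..nL}. i' \<noteq> i \<longrightarrow> A i j - A i' j \<ge> d)"
    and sparse: "\<And>i i'. i \<in> {0..nL} \<Longrightarrow> i' \<in> {1..nL} \<Longrightarrow> i \<noteq> i' \<Longrightarrow> A i i' \<le> c\<^sub>0 / real nL"
    and dv: "0 < d" "0 < v" and l: "0 < l" "l \<le> 1"
    and eps: "0 < \<epsilon>" "\<epsilon> \<le> c_min / 8" "\<epsilon> \<le> e * c_min / 8"
    and small_leader: "c\<^sub>0 * (c_max + \<epsilon>) \<le> \<epsilon> * nL"
    and small_count: "16 * real nL ^ 3 * ln (real ((nL + 1) ^ T * (T + 1) ^ ((nL + 1) * n))) \<le> \<epsilon> * d\<^sup>2 * v * n * T"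
  shows "prob {\<omega>\<in>space M. \<bar>MAX (i, j)\<in>{0..nL} \<times> {1..n}. \<bar>A_hat T (\<lambda>t j. G t j \<omega>) (z \<omega>) i j - A i j\<bar>\<bar> > e}
    \<le> 2 * real (nL + 1) * real (n + 1) * exp (l\<^sup>2 * T * (c_max / nL) - l * (\<epsilon> * (T / nL))) + 1 / (T + 1)"
proof -
  define x where "x = real T / real nL"
  define C where "C = real ((nL + 1) ^ T * (T + 1) ^ ((nL + 1) * n))"
  \<comment> \<open>This is \<open>2 * D / (w * d^2)\<close> for the squared error bound
    \<open>D = 8 * ln C\<close> and separating sets of size at least
    \<open>w = v * n / nL\<close>.\<close>
  define \<eta> where "\<eta> = 2 * (8 * ln C) / (v * n / nL * d\<^sup>2)"
  have x: "0 < x" using pos by (simp add: x_def)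
  have rho_pos: "0 < \<rho> i" if "i \<in> {0..nL}" for i
  proof -
    have "0 < c_min / nL" using c pos by simp
    then show ?thesis using rho[OF that] by linarith
  qed
  have C: "real (T + 1) \<le> C"
  proof -
    have "T + 1 \<le> (T + 1) ^ ((nL + 1) * n)"
      using pos by (intro self_le_power) auto
    also have "\<dots> \<le> (nL + 1) ^ T * (T + 1) ^ ((nL + 1) * n)" by simp
    finally show ?thesis unfolding C_def by (rule of_nat_mono)
  qed
  have "0 < C" using C by simp
  \<comment> \<open>The level \<open>s = 2 * ln C\<close> makes the union bound
    \<open>C / C^2 = 1 / C\<close>, which is at most \<open>1 / (T + 1)\<close>, at the price of a
    squared error of \<open>8 * ln C\<close>.\<close>
  obtain E1 where E1: "E1 \<in> sets M" "prob E1 \<le> C / exp (2 * ln C)"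
    "\<And>\<omega> y. \<omega> \<in> space M - E1 \<Longrightarrow> regular \<omega> \<Longrightarrow> profile_mle nL n T (\<lambda>t j. G t j \<omega>) y \<Longrightarrow>
       (\<Sum>t=1..T. \<Sum>j=1..n. (A_hat T (\<lambda>t j. G t j \<omega>) y (y t) j - A (Z t \<omega>) j)\<^sup>2) \<le> 4 * (2 * ln C)"
    using mle_squared_error[OF rho_pos, of "2 * ln C"] unfolding C_def by blast
  have "exp (2 * ln C) = C * C"
    using \<open>0 < C\<close> by (simp only: mult_2 exp_add exp_ln)
  then have "prob E1 \<le> 1 / C"
    using E1(2) \<open>0 < C\<close> by simp
  also have "\<dots> \<le> 1 / (T + 1)"
    using C by (intro divide_left_mono) auto
  finally have pE1: "prob E1 \<le> 1 / (T + 1)" .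
  obtain E2 where E2: "E2 \<in> sets M"
    "prob E2 \<le> 2 * real (nL + 1) * real (n + 1) * exp (l\<^sup>2 * T * (c_max / nL) - l * (\<epsilon> * (T / nL)))"
    "\<And>\<omega> i. \<omega> \<in> space M - E2 \<Longrightarrow> i \<in> {0..nL} \<Longrightarrow> \<bar>\<Sum>t=1..T. of_bool (Z t \<omega> = i) - \<rho> i\<bar> < \<epsilon> * x"
    "\<And>\<omega> i j. \<omega> \<in> space M - E2 \<Longrightarrow> i \<in> {0..nL} \<Longrightarrow> j \<in> {1..n} \<Longrightarrow>
      \<bar>\<Sum>t=1..T. of_bool (Z t \<omega> = i) * (of_bool (G t j \<omega>) - A i j)\<bar> < \<epsilon> * x"
    using class_concentration[of "c_max / nL" l "\<epsilon> * x"] rho rho_pos l unfolding x_def by blast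
  obtain N where N: "{\<omega>\<in>space M. \<not> regular \<omega>} \<subseteq> N" "N \<in> sets M" "emeasure M N = 0"
    using AE_regular[OF rho_pos] by (rule AE_E)
  \<comment> \<open>After clearing denominators this is \<open>small_count\<close>: the misplaced
    observations of a group are at most \<open>\<epsilon> * x\<close>.\<close>
  have mu: "real nL * \<eta> \<le> \<epsilon> * x"
  proof -
    have "real nL * \<eta> = 16 * real nL ^ 3 * ln C / (d\<^sup>2 * v * n * nL)"
      using pos dv by (simp add: \<eta>_def field_simps eval_nat_numeral)
    also have "\<dots> \<le> \<epsilon> * d\<^sup>2 * v * n * T / (d\<^sup>2 * v * n * nL)"
      using small_count dv by (intro divide_right_mono) (auto simp: C_def)
    also have "\<dots> = \<epsilon> * x"
      using pos dv by (simp add: x_def)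
    finally show ?thesis .
  qed
  have eta_nonneg: "0 \<le> \<eta>"
    using C dv by (simp add: \<eta>_def)
  have dev: "\<bar>A_hat T (\<lambda>t j. G t j \<omega>) (z \<omega>) i j - A i j\<bar> \<le> e"
    if \<omega>: "\<omega> \<in> space M - (E1 \<union> E2 \<union> N)" and i: "i \<in> {0..nL}" and j: "j \<in> {1..n}" for \<omega> i j
  proof -
    have "\<bar>A_hat T (\<lambda>t j. G t j \<omega>) (z \<omega>) i j - A i j\<bar> \<le>
        (\<epsilon> * x + 2 * (real nL * \<eta>)) / ((c_min - \<epsilon>) * x - real nL * \<eta>)"
    proof (rule A_hat_mle_deviation[where D = "8 * ln C" and w = "v * n / nL" and d = d
          and \<kappa> = "c\<^sub>0 / nL" and mx = "(c_max + \<epsilon>) * x"])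
      show reg: "regular \<omega>" using N(1) \<omega> by blast
      show mle': "profile_mle nL n T (\<lambda>t j. G t j \<omega>) (z \<omega>)" using mle \<omega> by blast
      show "(\<Sum>t=1..T. \<Sum>j=1..n. (A_hat T (\<lambda>t j. G t j \<omega>) (z \<omega>) (z \<omega> t) j - A (Z t \<omega>) j)\<^sup>2) \<le> 8 * ln C"
        using E1(3)[OF _ reg mle'] \<omega> by simp
      show "(c_min - \<epsilon>) * x \<le> T * \<rho> i - \<epsilon> * x \<and> T * \<rho> i + \<epsilon> * x \<le> (c_max + \<epsilon>) * x"
        if "i \<in> {0..nL}" for i
      proof -
        have "T * (c_min / nL) \<le> T * \<rho> i" "T * \<rho> i \<le> T * (c_max / nL)"
          using rho[OF that] by (intro mult_left_mono; simp)+
        moreover have "T * (c_min / nL) = c_min * x" "T * (c_max / nL) = c_max * x"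
          by (simp_all add: x_def)
        ultimately show ?thesis by (simp add: left_diff_distrib distrib_right)
      qed
      show "2 * (8 * ln C) / (v * n / nL * d\<^sup>2) \<le> \<eta>" by (simp add: \<eta>_def)
      have "real (nL + 1) * \<eta> \<le> 2 * (real nL * \<eta>)"
        using mult_right_mono[OF _ eta_nonneg, of 1 "real nL"] pos by (simp add: algebra_simps)
      also have "\<dots> \<le> 2 * \<epsilon> * x" using mu by simp
      also have "\<dots> < (c_min - \<epsilon>) * x"
        using x eps c by (intro mult_strict_right_mono) auto
      finally show "real (nL + 1) * \<eta> < (c_min - \<epsilon>) * x" .
      \<comment> \<open>By \<open>small_leader\<close>, the expected number of edges from one class
        to a wrong leader is negligible against a class size.\<close>
      have "c\<^sub>0 / nL * ((c_max + \<epsilon>) * x) \<le> \<epsilon> * x"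
        using mult_right_mono[OF small_leader, of "x / nL"] pos x by simp
      then have "c\<^sub>0 / nL * ((c_max + \<epsilon>) * x) + \<epsilon> * x + real nL * \<eta> \<le> 3 * \<epsilon> * x"
        using mu by simp
      also have "\<dots> < (c_min - \<epsilon>) * x"
        using x eps c by (intro mult_strict_right_mono) auto
      finally show "c\<^sub>0 / nL * ((c_max + \<epsilon>) * x) + \<epsilon> * x + real nL * \<eta> < (c_min - \<epsilon>) * x" .
    qed (use E2(3,4) \<omega> sep sparse dv c pos i j in \<open>auto intro: less_imp_le\<close>)
    also have "\<dots> \<le> (3 * \<epsilon> * x) / (3 / 4 * c_min * x)"
    proof (intro frac_le)
      have "3 / 4 * c_min * x \<le> (c_min - 2 * \<epsilon>) * x"
        using x eps by (intro mult_right_mono) auto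
      then show "3 / 4 * c_min * x \<le> (c_min - \<epsilon>) * x - real nL * \<eta>"
        using mu by (simp add: algebra_simps)
    qed (use mu eps x c in auto)
    also have "\<dots> = 4 * \<epsilon> / c_min"
      using x c by (simp add: field_simps)
    also have "\<dots> \<le> e"
      using eps c by (simp add: pos_divide_le_eq)
    finally show ?thesis .
  qed
  have "{\<omega>\<in>space M. \<bar>MAX (i, j)\<in>{0..nL} \<times> {1..n}. \<bar>A_hat T (\<lambda>t j. G t j \<omega>) (z \<omega>) i j - A i j\<bar>\<bar> > e}
      \<subseteq> E1 \<union> E2 \<union> N"
  proof (rule subsetI, rule ccontr)
    fix \<omega>
    let ?f = "\<lambda>(i, j). \<bar>A_hat T (\<lambda>t j. G t j \<omega>) (z \<omega>) i j - A i j\<bar>"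
    assume \<omega>: "\<omega> \<in> {\<omega>\<in>space M. \<bar>MAX (i, j)\<in>{0..nL} \<times> {1..n}. \<bar>A_hat T (\<lambda>t j. G t j \<omega>) (z \<omega>) i j - A i j\<bar>\<bar> > e}"
      and "\<omega> \<notin> E1 \<union> E2 \<union> N"
    then have good: "\<omega> \<in> space M - (E1 \<union> E2 \<union> N)" by blast
    have "Max (?f ` ({0..nL} \<times> {1..n})) \<in> ?f ` ({0..nL} \<times> {1..n})"
      using pos by (intro Max_in) auto
    then obtain i j where "i \<in> {0..nL}" "j \<in> {1..n}" "Max (?f ` ({0..nL} \<times> {1..n})) = ?f (i, j)"
      by blast
    then have "\<bar>Max (?f ` ({0..nL} \<times> {1..n}))\<bar> \<le> e"
      using dev[OF good, of i j] by simp
    with \<omega> show False by simp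
  qed
  then have "prob {\<omega>\<in>space M. \<bar>MAX (i, j)\<in>{0..nL} \<times> {1..n}. \<bar>A_hat T (\<lambda>t j. G t j \<omega>) (z \<omega>) i j - A i j\<bar>\<bar> > e}
      \<le> prob (E1 \<union> E2 \<union> N)"
    using E1(1) E2(1) N(2) by (intro finite_measure_mono) auto
  moreover have "prob (E1 \<union> E2 \<union> N) \<le> prob (E1 \<union> E2) + prob N" "prob (E1 \<union> E2) \<le> prob E1 + prob E2"
    using E1(1) E2(1) N(2) by (auto intro!: measure_Un_le)
  moreover have "prob N = 0" using N(3) by (simp add: measure_def)
  ultimately show ?thesis using pE1 E2(2) by linarith
qed

section \<open>Passage to the limit along the sequence\<close>

theorem theorem10:
  fixes M :: "nat \<Rightarrow> 'a measure"
    and nL n T :: "nat \<Rightarrow> nat"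
    and \<rho> :: "nat \<Rightarrow> nat \<Rightarrow> real"
    and A :: "nat \<Rightarrow> nat \<Rightarrow> nat \<Rightarrow> real"
    and Z :: "nat \<Rightarrow> nat \<Rightarrow> 'a \<Rightarrow> nat"
    and G :: "nat \<Rightarrow> nat \<Rightarrow> nat \<Rightarrow> 'a \<Rightarrow> bool"
    and z_hat :: "nat \<Rightarrow> 'a \<Rightarrow> nat \<Rightarrow> nat"
    and d v :: "nat \<Rightarrow> real"
    and c_min c_max c\<^sub>0 :: real
  assumes model: "\<And>k. hub_model (M k) (nL k) (n k) (T k) (\<rho> k) (A k) (Z k) (G k)"
    and nL_lim: "filterlim nL at_top sequentially"
    and n_lim: "filterlim n at_top sequentially"
    and T_lim: "filterlim T at_top sequentially"
    and c_pos: "c_min > 0" "c_max > 0" "c\<^sub>0 > 0"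
    and rho_min: "\<And>k. (MIN i\<in>{0..nL k}. \<rho> k i) = c_min / real (nL k)"
    and rho_max: "\<And>k. (MAX i\<in>{0..nL k}. \<rho> k i) = c_max / real (nL k)"
    and d_range: "\<And>k. 0 < d k \<and> d k \<le> 1"
    and v_range: "\<And>k. 0 < v k \<and> v k \<le> 1"
    and separation: "\<And>k i. i \<in> {1..nL k} \<Longrightarrow>
          \<exists>V \<subseteq> {1..n k}. real (card V) \<ge> v k * real (n k) / real (nL k) \<and>
            (\<forall>j\<in>V. \<forall>i'\<in>{0..nL k}. i' \<noteq> i \<longrightarrow> A k i j - A k i' j \<ge> d k)"
    and leader_sparse: "\<And>k i i'. i \<in> {0..nL k} \<Longrightarrow> i' \<in> {1..nL k} \<Longrightarrow> i \<noteq> i' \<Longrightarrow>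
          A k i i' \<le> c\<^sub>0 / real (nL k)"
    and rate1: "(\<lambda>k. (real (nL k) ^ 2 * ln (real (nL k))) / real (T k)) \<longlonglongrightarrow> 0"
    and rate2: "(\<lambda>k. (real (nL k) ^ 5 * ln (real (T k))) / (d k ^ 2 * v k * real (T k))) \<longlonglongrightarrow> 0"
    and rate3: "(\<lambda>k. (real (nL k) ^ 8 * ln (real (nL k))) / (d k ^ 4 * v k ^ 2 * real (n k))) \<longlonglongrightarrow> 0"
    and rate4: "(\<lambda>k. (real (nL k) * ln (real (n k))) / real (T k)) \<longlonglongrightarrow> 0"
    and z_hat_measurable: "\<And>k t. t \<in> {1..T k} \<Longrightarrow>
          (\<lambda>\<omega>. z_hat k \<omega> t) \<in> measurable (M k) (count_space UNIV)"
    and z_hat_mle: "\<And>k \<omega>. \<omega> \<in> space (M k) \<Longrightarrow>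
          profile_mle (nL k) (n k) (T k) (\<lambda>t j. G k t j \<omega>) (z_hat k \<omega>)"
  shows "small_o_p_1 M (\<lambda>k \<omega>.
           MAX (i, j)\<in>{0..nL k} \<times> {1..n k}.
             \<bar>A_hat (T k) (\<lambda>t j. G k t j \<omega>) (z_hat k \<omega>) i j - A k i j\<bar>)"
  unfolding small_o_p_1_def
proof (intro allI impI)
  fix e :: real assume e: "0 < e"
  define \<epsilon> where "\<epsilon> = min (c_min / 8) (e * c_min / 8)"
  \<comment> \<open>Chosen so that in the exponent
    \<open>l^2 * c_max * x - l * \<epsilon> * x\<close> the quadratic term is at most half of the
    linear one, which leaves \<open>- \<kappa> * x\<close> with \<open>x = T / nL\<close>.\<close>
  define l where "l = min 1 (\<epsilon> / (2 * c_max))"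
  define \<kappa> where "\<kappa> = l * \<epsilon> / 2"
  have eps: "0 < \<epsilon>" "\<epsilon> \<le> c_min / 8" "\<epsilon> \<le> e * c_min / 8"
    using c_pos e by (auto simp: \<epsilon>_def)
  have l: "0 < l" "l \<le> 1" "l * c_max \<le> \<epsilon> / 2"
  proof -
    show "0 < l" "l \<le> 1" using eps c_pos by (auto simp: l_def)
    have "l * c_max \<le> \<epsilon> / (2 * c_max) * c_max"
      using c_pos by (intro mult_right_mono) (auto simp: l_def)
    then show "l * c_max \<le> \<epsilon> / 2" using c_pos by simp
  qed
  have kappa: "0 < \<kappa>" using l eps by (simp add: \<kappa>_def)
  let ?p = "\<lambda>k. measure (M k) {\<omega> \<in> space (M k). \<bar>MAX (i, j)\<in>{0..nL k} \<times> {1..n k}.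
    \<bar>A_hat (T k) (\<lambda>t j. G k t j \<omega>) (z_hat k \<omega>) i j - A k i j\<bar>\<bar> > e}"
  have real_lim: "filterlim (\<lambda>k. real (n k)) at_top sequentially" "filterlim (\<lambda>k. real (T k)) at_top sequentially"
    "filterlim (\<lambda>k. real (nL k)) at_top sequentially"
    by (intro filterlim_compose[OF filterlim_real_sequentially] n_lim T_lim nL_lim)+
  have "eventually (\<lambda>k. 2 \<le> nL k \<and> 2 \<le> T k \<and> 1 \<le> n k) sequentially"
    using nL_lim T_lim n_lim unfolding filterlim_at_top by (intro eventually_conj) auto
  moreover have "eventually (\<lambda>k. c\<^sub>0 * (c_max + \<epsilon>) / \<epsilon> \<le> real (nL k)) sequentially"
    using real_lim(3) unfolding filterlim_at_top by blast
  moreover have "eventually (\<lambda>k. (real (nL k) ^ 5 * ln (real (T k))) / (d k ^ 2 * v k * real (T k)) < \<epsilon> / 128) sequentially"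
    using eps by (intro order_tendstoD(2)[OF rate2]) auto
  moreover have "eventually (\<lambda>k. (real (nL k) ^ 8 * ln (real (nL k))) / (d k ^ 4 * v k ^ 2 * real (n k)) < \<epsilon> / 64) sequentially"
    using eps by (intro order_tendstoD(2)[OF rate3]) auto
  moreover have "eventually (\<lambda>k. (real (nL k) * ln (real (n k))) / real (T k) < \<kappa> / 4) sequentially"
    using kappa by (intro order_tendstoD(2)[OF rate4]) auto
  ultimately have bound: "eventually (\<lambda>k. ?p k \<le> 8 / real (n k) + 1 / real (T k)) sequentially"
  proof eventually_elim
    case (elim k)
    then have pos: "2 \<le> nL k" "2 \<le> T k" "1 \<le> n k" by auto
    interpret hub_model "M k" "nL k" "n k" "T k" "\<rho> k" "A k" "Z k" "G k" by (rule model)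
    have rho: "c_min / nL k \<le> \<rho> k i \<and> \<rho> k i \<le> c_max / nL k" if "i \<in> {0..nL k}" for i
      unfolding rho_min[symmetric] rho_max[symmetric] using that by (intro conjI Min_le Max_ge) auto
    have "?p k \<le> 2 * real (nL k + 1) * real (n k + 1) *
        exp (l\<^sup>2 * T k * (c_max / nL k) - l * (\<epsilon> * (T k / nL k))) + 1 / (T k + 1)"
    proof (rule prob_max_deviation_le[where v = "v k" and d = "d k" and c_min = c_min and c\<^sub>0 = c\<^sub>0])
      show "c\<^sub>0 * (c_max + \<epsilon>) \<le> \<epsilon> * real (nL k)"
        using elim(2) eps by (simp add: pos_divide_le_eq mult.commute)
      show "16 * real (nL k) ^ 3 * ln (real ((nL k + 1) ^ T k * (T k + 1) ^ ((nL k + 1) * n k)))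
          \<le> \<epsilon> * (d k)\<^sup>2 * v k * n k * T k"
        using d_range[of k] v_range[of k] elim(3,4) pos eps by (intro log_count_le) auto
    qed (use pos z_hat_mle c_pos rho separation leader_sparse d_range v_range l eps in auto)
    moreover have "2 * real (nL k + 1) * real (n k + 1) *
        exp (l\<^sup>2 * T k * (c_max / nL k) - l * (\<epsilon> * (T k / nL k))) \<le> 8 / real (n k)"
    proof -
      define x where "x = real (T k) / real (nL k)"
      have x: "0 < x" using pos by (simp add: x_def)
      have "l\<^sup>2 * T k * (c_max / nL k) - l * (\<epsilon> * (T k / nL k)) = (l * c_max) * (l * x) - l * \<epsilon> * x"
        by (simp add: x_def power2_eq_square mult_ac)
      also have "\<dots> \<le> (\<epsilon> / 2) * (l * x) - l * \<epsilon> * x"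
        using l x by (intro diff_right_mono mult_right_mono) auto
      also have "\<dots> = - (\<kappa> * x)"
        by (simp add: \<kappa>_def)
      \<comment> \<open>Here \<open>rate4\<close> enters: eventually \<open>ln n\<close> is at most
        \<open>\<kappa> / 4\<close> times \<open>T / nL\<close>.\<close>
      also have "\<dots> \<le> - (4 * ln (real (n k)))"
        using elim(5) pos by (simp add: x_def field_simps)
      finally have "exp (l\<^sup>2 * T k * (c_max / nL k) - l * (\<epsilon> * (T k / nL k))) \<le> exp (- (4 * ln (real (n k))))"
        by simp
      also have "\<dots> = 1 / real (n k) ^ 4"
        using pos exp_of_nat_mult[of 4 "ln (real (n k))"] by (simp add: exp_minus inverse_eq_divide)
      \<comment> \<open>As \<open>nL \<le> n\<close>, the number of sums in the union bound is of
        order at most \<open>n^2\<close>, which the tail \<open>n^(-4)\<close> outweighs.\<close>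
      finally have "2 * real (nL k + 1) * real (n k + 1) * exp (l\<^sup>2 * T k * (c_max / nL k) - l * (\<epsilon> * (T k / nL k)))
          \<le> (2 * (2 * real (n k)) * (2 * real (n k))) * (1 / real (n k) ^ 4)"
        using pos nL_le_n by (intro mult_mono) auto
      also have "\<dots> = 8 / real (n k) / real (n k)"
        using pos by (simp add: field_simps eval_nat_numeral)
      also have "\<dots> \<le> 8 / real (n k)"
        using pos by (simp add: divide_le_eq field_simps)
      finally show ?thesis .
    qed
    moreover have "1 / real (T k + 1) \<le> 1 / real (T k)"
      using pos by (intro divide_left_mono) auto
    ultimately show ?case by linarith
  qed
  have "(\<lambda>k. 8 / real (n k) + 1 / real (T k)) \<longlonglongrightarrow> 0 + 0"
    by (intro tendsto_add real_tendsto_divide_at_top[OF tendsto_const] real_lim)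
  then show "?p \<longlonglongrightarrow> 0"
    using bound by (intro tendsto_sandwich[OF _ bound tendsto_const]) auto
qed

end
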